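(* Let $X=V(F)\subseteq\mathbb{CP}^3$ be any smooth symmetric cubic surface over the complex numbers. Then the set of the $27$ lines on $X$ is, as an $S_4$-set, isomorphic to $$[S_4/C_2]+[S_4/C_2']+[S_4/D_8],$$ where $C_2=\langle(1\ 2)\rangle$, $C_2'=\langle(1\ 3)(2\ 4)\rangle$ (two non-conjugate subgroups of order two) and $D_8\le S_4$ is a dihedral subgroup of order $8$. Explicitly, there are $12$ lines in an orbit with isotropy group $C_2$, $12$ lines in an orbit with isotropy group $C_2'$, and $3$ lines in an orbit with isotropy group $D_8$ (isotropy groups up to conjugacy).
   Context: $S_4$ acts on $\mathbb{CP}^3$ by permuting the homogeneous coordinates $x_0,x_1,x_2,x_3$. A cubic surface $X=V(F)$, with $F$ a homogeneous polynomial of degree $3$, is called ($S_4$-)symmetric if it is fixed by this action; equivalently $F(x_0,x_1,x_2,x_3)$ is a symmetric polynomial. The group $S_4$ then acts on the set of lines contained in $X$. The sum $+$ denotes disjoint union of $S_4$-sets (addition in the Burnside ring). *)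

theory Defs
  imports
    "HOL-Analysis.Analysis"
    "HOL-Library.Poly_Mapping"
    "HOL-Library.Numeral_Type"
    "HOL-Algebra.Group_Action"
    "HOL-Algebra.Left_Coset"
    "HOL-Algebra.Generated_Groups"
    "HOL-Algebra.Multiplicative_Group"
begin

section \<open>Polynomials in finitely many variables\<close>

text \<open>A monomial is its exponent vector, and a polynomial maps monomials to coefficients.\<close>

type_synonym 'n cpoly = "('n \<Rightarrow>\<^sub>0 nat) \<Rightarrow>\<^sub>0 complex"

definition eval_poly :: "'n::finite cpoly \<Rightarrow> complex^'n \<Rightarrow> complex" where
  "eval_poly F x =
     (\<Sum>m\<in>Poly_Mapping.keys F.
        Poly_Mapping.lookup F m * (\<Prod>i\<in>UNIV. (x $ i) ^ Poly_Mapping.lookup m i))"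

definition homogeneous :: "nat \<Rightarrow> 'n::finite cpoly \<Rightarrow> bool" where
  "homogeneous d F \<longleftrightarrow>
     (\<forall>m\<in>Poly_Mapping.keys F. (\<Sum>i\<in>UNIV. Poly_Mapping.lookup m i) = d)"

text \<open>The formal partial derivative. For monomials not involving \<open>i\<close> the exponent subtraction
  truncates, but then the coefficient is zero.\<close>

definition partial_deriv :: "'n::finite \<Rightarrow> 'n cpoly \<Rightarrow> 'n cpoly" where
  "partial_deriv i F =
     (\<Sum>m\<in>Poly_Mapping.keys F.
        Poly_Mapping.single (m - Poly_Mapping.single i 1)
          (of_nat (Poly_Mapping.lookup m i) * Poly_Mapping.lookup F m))"

section \<open>Projective space, surfaces and lines\<close>

text \<open>A point of projective space is a one-dimensional complex subspace, and a line is
  the set of points lying in a two-dimensional complex subspace. Here \<open>vec.subspace\<close> and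
  \<open>vec.dim\<close> are taken over the scalar field \<open>complex\<close>. The index type \<open>4\<close>
  consists of the residues modulo 4, so \<open>complex^4\<close> has the coordinates
  \<open>x $ 0, x $ 1, x $ 2, x $ 3\<close>.\<close>

type_synonym point = "(complex^4) set"

definition CP3 :: "point set" where
  "CP3 = {P. vec.subspace P \<and> vec.dim P = 1}"

definition is_line :: "point set \<Rightarrow> bool" where
  "is_line l \<longleftrightarrow> (\<exists>W. vec.subspace W \<and> vec.dim W = 2 \<and> l = {P \<in> CP3. P \<subseteq> W})"

definition zero_locus :: "4 cpoly \<Rightarrow> point set" where
  "zero_locus F = {P \<in> CP3. \<forall>x\<in>P. eval_poly F x = 0}"

definition lines_on :: "point set \<Rightarrow> point set set" where
  "lines_on X = {l. is_line l \<and> l \<subseteq> X}"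

text \<open>The Jacobian criterion. It is a condition on the equation and not only on the zero set:
  it excludes the zero polynomial and non-reduced equations.\<close>

definition smooth_surface :: "4 cpoly \<Rightarrow> bool" where
  "smooth_surface F \<longleftrightarrow>
     (\<forall>x. x \<noteq> 0 \<longrightarrow> eval_poly F x = 0 \<longrightarrow> (\<exists>i. eval_poly (partial_deriv i F) x \<noteq> 0))"

section \<open>The symmetric group acting by permutation of coordinates\<close>

text \<open>The group of all permutations of the four indices. In the type \<open>4\<close> we have
  \<open>4 = 0\<close>, so the indices may be named \<open>1, 2, 3, 4\<close> as well as
  \<open>0, 1, 2, 3\<close>.\<close>

abbreviation S4 :: "(4 \<Rightarrow> 4) monoid" where
  "S4 \<equiv> BijGroup UNIV"

text \<open>The inverse makes this a left action: the basis vector with index \<open>i\<close> goes to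
  the one with index \<open>\<sigma> i\<close>.\<close>

definition perm_vec :: "(4 \<Rightarrow> 4) \<Rightarrow> complex^4 \<Rightarrow> complex^4" where
  "perm_vec \<sigma> x = (\<chi> i. x $ (inv_into UNIV \<sigma> i))"

definition perm_point :: "(4 \<Rightarrow> 4) \<Rightarrow> point \<Rightarrow> point" where
  "perm_point \<sigma> P = perm_vec \<sigma> ` P"

definition symmetric_surface :: "point set \<Rightarrow> bool" where
  "symmetric_surface X \<longleftrightarrow> (\<forall>\<sigma>\<in>carrier S4. perm_point \<sigma> ` X = X)"

definition C2 :: "(4 \<Rightarrow> 4) set" where
  "C2 = generate S4 {Transposition.transpose 1 2}"

definition C2' :: "(4 \<Rightarrow> 4) set" where
  "C2' = generate S4 {Transposition.transpose 1 3 \<circ> Transposition.transpose 2 4}"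

definition conjugate_in :: "('a, 'm) monoid_scheme \<Rightarrow> 'a set \<Rightarrow> 'a set \<Rightarrow> bool" where
  "conjugate_in G H K \<longleftrightarrow> (\<exists>g\<in>carrier G. K = g <#\<^bsub>G\<^esub> H #>\<^bsub>G\<^esub> inv\<^bsub>G\<^esub> g)"

text \<open>Dihedral groups are indexed by half their order, with \<open>n \<ge> 3\<close> intended.\<close>

definition dihedral_group :: "nat \<Rightarrow> ('a, 'm) monoid_scheme \<Rightarrow> bool" where
  "dihedral_group n G \<longleftrightarrow>
     group G \<and> order G = 2 * n \<and>
     (\<exists>r\<in>carrier G. \<exists>s\<in>carrier G.
        generate G {r, s} = carrier G \<and> group.ord G r = n \<and> group.ord G s = 2 \<and>
        s \<otimes>\<^bsub>G\<^esub> r \<otimes>\<^bsub>G\<^esub> s = inv\<^bsub>G\<^esub> r)"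

section \<open>Sets with a group action\<close>

text \<open>A pair of an underlying set \<open>E\<close> and an action \<open>\<phi>\<close>, subject to
  \<open>group_action G E \<phi>\<close>. That locale wants every \<open>\<phi> g\<close> to be
  extensional on \<open>E\<close>, hence the restrictions below.\<close>

type_synonym ('g, 'b) gset = "'b set \<times> ('g \<Rightarrow> 'b \<Rightarrow> 'b)"

definition is_gset :: "('g, 'm) monoid_scheme \<Rightarrow> ('g, 'b) gset \<Rightarrow> bool" where
  "is_gset G X \<longleftrightarrow> group_action G (fst X) (snd X)"

definition gset_iso ::
    "('g, 'm) monoid_scheme \<Rightarrow> ('g, 'b) gset \<Rightarrow> ('g, 'c) gset \<Rightarrow> bool" where
  "gset_iso G X Y \<longleftrightarrow>
     is_gset G X \<and> is_gset G Y \<and>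
     (\<exists>f. bij_betw f (fst X) (fst Y) \<and>
          (\<forall>g\<in>carrier G. \<forall>x\<in>fst X. f (snd X g x) = snd Y g (f x)))"

definition gset_sum :: "('g, 'b) gset \<Rightarrow> ('g, 'c) gset \<Rightarrow> ('g, 'b + 'c) gset" where
  "gset_sum X Y =
     (fst X <+> fst Y, \<lambda>g. \<lambda>z\<in>fst X <+> fst Y. map_sum (snd X g) (snd Y g) z)"

definition coset_gset :: "('g, 'm) monoid_scheme \<Rightarrow> 'g set \<Rightarrow> ('g, 'g set) gset" where
  "coset_gset G H = (lcosets\<^bsub>G\<^esub> H, \<lambda>g. \<lambda>C\<in>lcosets\<^bsub>G\<^esub> H. g <#\<^bsub>G\<^esub> C)"

definition line_action :: "point set \<Rightarrow> (4 \<Rightarrow> 4) \<Rightarrow> point set \<Rightarrow> point set" where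
  "line_action X \<sigma> = (\<lambda>l\<in>lines_on X. perm_point \<sigma> ` l)"

definition lines_gset :: "point set \<Rightarrow> (4 \<Rightarrow> 4, point set) gset" where
  "lines_gset X = (lines_on X, line_action X)"

section \<open>Dihedral subgroups of order eight exist\<close>

text \<open>The affine maps \<open>x \<mapsto> \<plusminus> x + b\<close> of the residues modulo 4.\<close>

lemma exists_dihedral_subgroup: "\<exists>D. subgroup D S4 \<and> dihedral_group 4 (S4\<lparr>carrier := D\<rparr>)"
proof -
  define R where "R b = (\<lambda>x::4. x + b)" for b
  define S where "S b = (\<lambda>x::4. b - x)" for b
  define D where "D = range R \<union> range S"
  have bij: "bij (R b)" "bij (S b)" for b
    unfolding R_def S_def by (rule bij_betw_byWitness[where f' = "\<lambda>x. x - b"]; auto)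
      (rule bij_betw_byWitness[where f' = "\<lambda>x. b - x"]; auto)
  interpret G: group S4 by (rule group_BijGroup)
  have car: "f \<in> carrier S4 \<longleftrightarrow> bij f" for f
    by (simp add: BijGroup_def Bij_def)
  have mul: "f \<otimes>\<^bsub>S4\<^esub> g = (\<lambda>x. f (g x))" if "bij f" "bij g" for f g
    using that by (simp add: BijGroup_def Bij_def compose_def restrict_def)
  have one: "\<one>\<^bsub>S4\<^esub> = R 0"
    by (simp add: BijGroup_def R_def restrict_def)
  have comp: "R a \<otimes>\<^bsub>S4\<^esub> R b = R (a + b)" "R a \<otimes>\<^bsub>S4\<^esub> S b = S (a + b)"
    "S a \<otimes>\<^bsub>S4\<^esub> R b = S (a - b)" "S a \<otimes>\<^bsub>S4\<^esub> S b = R (a - b)" for a b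
    by (simp_all add: mul bij) (simp_all add: R_def S_def algebra_simps)
  have inv: "inv\<^bsub>S4\<^esub> (R b) = R (- b)" "inv\<^bsub>S4\<^esub> (S b) = S b" for b
    by (rule G.inv_equality; simp add: comp one car bij)+
  have sub: "subgroup D S4"
    by (rule G.subgroupI) (auto simp: D_def car bij inv comp)
  let ?H = "S4\<lparr>carrier := D\<rparr>"
  interpret H: group ?H
    using sub by (rule G.subgroup_imp_group)
  have RD: "R b \<in> D" "S b \<in> D" for b
    by (auto simp: D_def)
  have four: "b = 0 \<or> b = 1 \<or> b = 2 \<or> b = 3" for b :: 4
    using exhaust_4[of b] by auto
  have injR: "R a = R b \<longleftrightarrow> a = b" and injS: "S a = S b \<longleftrightarrow> a = b" for a b
    by (auto simp: R_def S_def fun_eq_iff)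
  have "R a \<noteq> S b" for a b
  proof
    assume "R a = S b"
    then have "R a 0 = S b 0" "R a 1 = S b 1" by simp_all
    then show False by (simp add: R_def S_def)
  qed
  then have "range R \<inter> range S = {}" by auto
  then have card: "card D = 8"
    by (simp add: D_def card_Un_disjoint card_image inj_on_def injR injS)
  have ordR: "H.ord (R 1) = 4"
  proof -
    have 1: "R 1 [^]\<^bsub>?H\<^esub> (2::nat) = R 2"
      by (simp add: numeral_2_eq_2 comp one)
    have 2: "R 1 [^]\<^bsub>?H\<^esub> (4::nat) = \<one>\<^bsub>?H\<^esub>"
      by (simp add: eval_nat_numeral comp one injR)
    have "H.ord (R 1) dvd 4"
      using 2 H.pow_eq_id[of "R 1" 4] RD by simp
    moreover have "\<not> H.ord (R 1) dvd 2"
      using 1 H.pow_eq_id[of "R 1" 2] RD by (simp add: one injR)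
    ultimately have "H.ord (R 1) \<le> 4" "H.ord (R 1) dvd 4" "\<not> H.ord (R 1) dvd 2"
      by (auto dest: dvd_imp_le)
    moreover from this have "H.ord (R 1) \<noteq> 0" "H.ord (R 1) \<noteq> 3" by (auto intro: ccontr)
    ultimately show ?thesis by (auto simp: le_Suc_eq numeral_eq_Suc)
  qed
  have ordS: "H.ord (S 0) = 2"
  proof -
    have "S 0 [^]\<^bsub>?H\<^esub> (2::nat) = \<one>\<^bsub>?H\<^esub>"
      by (simp add: numeral_2_eq_2 comp one)
    then have "H.ord (S 0) dvd 2"
      using H.pow_eq_id[of "S 0" 2] RD by simp
    moreover have "H.ord (S 0) \<noteq> 1"
      using H.ord_eq_1[of "S 0"] RD \<open>\<And>a b. R a \<noteq> S b\<close>[of 0 0] by (simp add: one)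
    ultimately show ?thesis using two_is_prime_nat prime_nat_iff by blast
  qed
  have gen: "generate ?H {R 1, S 0} = D"
  proof
    show "generate ?H {R 1, S 0} \<subseteq> D"
      using H.generate_incl[of "{R 1, S 0}"] RD by simp
    have m: "x \<otimes>\<^bsub>S4\<^esub> y \<in> generate ?H {R 1, S 0}"
      if "x \<in> generate ?H {R 1, S 0}" "y \<in> generate ?H {R 1, S 0}" for x y
      using generate.eng[OF that] by simp
    have 0: "R 0 \<in> generate ?H {R 1, S 0}"
      using generate.one[of ?H] by (simp add: one)
    have 1: "R 1 \<in> generate ?H {R 1, S 0}" and s: "S 0 \<in> generate ?H {R 1, S 0}"
      by (auto intro: generate.incl)
    have 2: "R 2 \<in> generate ?H {R 1, S 0}" using m[OF 1 1] by (simp add: comp)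
    have 3: "R 3 \<in> generate ?H {R 1, S 0}" using m[OF 1 2] by (simp add: comp)
    have R: "R b \<in> generate ?H {R 1, S 0}" for b
      using four[of b] 0 1 2 3 by auto
    have "S b \<in> generate ?H {R 1, S 0}" for b
      using m[OF R[of b] s] by (simp add: comp)
    with R show "D \<subseteq> generate ?H {R 1, S 0}"
      by (auto simp: D_def)
  qed
  have rel: "S 0 \<otimes>\<^bsub>?H\<^esub> R 1 \<otimes>\<^bsub>?H\<^esub> S 0 = inv\<^bsub>?H\<^esub> (R 1)"
    using G.m_inv_consistent[OF sub RD(1)] by (simp add: comp inv)
  have "dihedral_group 4 ?H"
    unfolding dihedral_group_def order_def
    using H.group_axioms card gen ordR ordS rel RD
    by (intro conjI bexI[of _ "R 1"] bexI[of _ "S 0"]) simp_all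
  with sub show ?thesis by blast
qed

end

theory Submission
  imports Defs "HOL-Computational_Algebra.Fundamental_Theorem_Algebra"
begin

text \<open>The proof turns the hypothesis on the surface into a normal form of its equation, and then finds the
27 lines explicitly.

\<^bold>\<open>The equation.\<close> Only the zero set is assumed to be symmetric. A cubic form that vanishes on the
zero set of a smooth cubic form \<open>F\<close> is a multiple of \<open>F\<close> (\<open>vanishing_cubic_proportional\<close>), so
every permutation \<open>\<sigma>\<close> multiplies \<open>F\<close> by a scalar \<open>\<kappa> \<sigma>\<close>, and \<open>\<kappa>\<close> is a character. It takes the
same value \<open>\<plusminus>1\<close> on all transpositions, and the value \<open>-1\<close> would make \<open>(1 : 1 : 1 : 1)\<close> a singular point.
Hence \<open>F\<close> is invariant, so \<open>F = a p\<^sub>1\<^sup>3 + b p\<^sub>1 p\<^sub>2 + c p\<^sub>3\<close> with the power sums \<open>p\<^sub>d\<close> of the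
coordinates (\<open>symmetric_cubic_normal_form\<close>). By smoothness certain expressions in \<open>a\<close>, \<open>b\<close>
and \<open>c\<close> do not vanish, one for each point that would otherwise be singular.

\<^bold>\<open>The lines.\<close> On the plane \<open>p\<^sub>1 = 0\<close> the equation becomes \<open>p\<^sub>3 = 0\<close>, and there \<open>p\<^sub>3\<close> is
\<open>3 (x\<^sub>1 + x\<^sub>2) (x\<^sub>1 + x\<^sub>3) (x\<^sub>1 + x\<^sub>4)\<close>. The plane therefore meets the surface in three lines, which
the group permutes: the orbit with stabilizer \<open>D\<^sub>8\<close>. Any other line of the surface meets the
plane in a point of one of these three, so after a permutation of coordinates it contains some
\<open>(r, -r, s, -s)\<close>. The planes through the line \<open>{(r, -r, s, -s)}\<close> are spanned by it and a vector
\<open>(p, p, q, q)\<close>, and on such a plane the equation splits into the equation of that line and a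
diagonal conic (\<open>sym_form_pairs\<close>). So another line of the surface in this plane forces one of the three
coefficients of the conic to vanish. The vanishing of a coefficient of one of the two squares
gives the lines through the point \<open>(1 : -1 : 0 : 0)\<close> and its translates, at which three coplanar
lines of the surface meet (an Eckardt point); they have stabilizers conjugate to \<open>C2\<close>. The vanishing of the
remaining coefficient gives lines with stabilizers conjugate to \<open>C2'\<close>. In both cases the finitely many
solutions are permuted transitively, so every line of the surface is a translate of one of three
explicit lines (\<open>every_line_moves_to_base\<close>).

\<^bold>\<open>The orbits.\<close> The stabilizers of the explicit lines are read off from the point
in which they meet the plane \<open>p\<^sub>1 = 0\<close>, and the orbits are coset spaces (\<open>orbit_iso_cosets\<close>). The orbit
lengths are \<open>24 / 2\<close>, \<open>24 / 2\<close> and \<open>3\<close>. A given dihedral subgroup of order 8 is a 2-group acting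
on the three lines of the last orbit, so it fixes one of them, and then it is the stabilizer of that line
because both have order 8.\<close>

section \<open>Cubic polynomials as symmetric trilinear forms\<close>

text \<open>A cubic form is handled through its polarization \<open>T\<close>: the form is \<open>x \<mapsto> T x x x\<close>, and its derivative
at \<open>x\<close> in direction \<open>y\<close> is \<open>3 * T x x y\<close>. Linear changes of coordinates and restrictions to
lines then need no manipulation of monomials.\<close>

locale cubic_form =
  fixes T :: "complex^'n::finite \<Rightarrow> complex^'n \<Rightarrow> complex^'n \<Rightarrow> complex"
  assumes swap12: "T x y z = T y x z" and swap23: "T x y z = T x z y"
    and add1: "T (x + x') y z = T x y z + T x' y z"
    and scale1: "T (c *s x) y z = c * T x y z"
begin

lemma add2: "T x (y + y') z = T x y z + T x y' z"
  by (metis swap12 add1)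

lemma add3: "T x y (z + z') = T x y z + T x y z'"
  by (metis swap23 add2)

lemma scale2: "T x (c *s y) z = c * T x y z"
  by (metis swap12 scale1)

lemma scale3: "T x y (c *s z) = c * T x y z"
  by (metis swap23 scale2)

lemma zero [simp]: "T 0 y z = 0" "T x 0 z = 0" "T x y 0 = 0"
  using scale1[of 0 0 y z] scale2[of x 0 0 z] scale3[of x y 0 0] by simp_all

lemma sum3: "T x y (\<Sum>i\<in>I. f i) = (\<Sum>i\<in>I. T x y (f i))"
  by (induction I rule: infinite_finite_induct) (simp_all add: add3)

lemma value_on_line:
  "T (x + t *s y) (x + t *s y) (x + t *s y)
    = T x x x + 3 * t * T x x y + 3 * t^2 * T x y y + t^3 * T y y y"
proof -
  have 1: "T x y x = T x x y" "T y x x = T x x y" "T y x y = T x y y" "T y y x = T x y y"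
    by (metis swap12 swap23)+
  show ?thesis
    by (simp add: add1 add2 add3 scale1 scale2 scale3 1 algebra_simps power2_eq_square power3_eq_cube)
qed

text \<open>The form determines \<open>T\<close>, so identities between cubic forms carry over to their polarizations.\<close>

lemma polarization:
  "6 * T x y z = T (x+y+z) (x+y+z) (x+y+z) - T (x+y) (x+y) (x+y) - T (x+z) (x+z) (x+z)
     - T (y+z) (y+z) (y+z) + T x x x + T y y y + T z z z"
proof -
  have 1: "T x z y = T x y z" "T y x z = T x y z" "T y z x = T x y z" "T z x y = T x y z" "T z y x = T x y z"
     by (metis swap12 swap23)+
  have 2: "T u v u = T u u v" "T v u u = T u u v" for u v
    by (metis swap12 swap23)+
  show ?thesis
    by (simp add: add1 add2 add3 1 2[of x y] 2[of x z] 2[of y x] 2[of y z] 2[of z x] 2[of z y])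
qed

end

lemma eval_poly_superset:
  assumes "finite A" "Poly_Mapping.keys F \<subseteq> A"
  shows "eval_poly F x =
    (\<Sum>m\<in>A. Poly_Mapping.lookup F m * (\<Prod>i\<in>UNIV. (x $ i) ^ Poly_Mapping.lookup m i))"
  unfolding eval_poly_def
  by (rule sum.mono_neutral_left) (use assms in \<open>auto simp: in_keys_iff\<close>)

lemma eval_poly_zero [simp]: "eval_poly 0 x = 0"
  by (simp add: eval_poly_def)

lemma eval_poly_single [simp]:
  "eval_poly (Poly_Mapping.single m c) x = c * (\<Prod>i\<in>UNIV. (x $ i) ^ Poly_Mapping.lookup m i)"
  by (subst eval_poly_superset[of "{m}"]) auto

lemma eval_poly_add: "eval_poly (F + G) x = eval_poly F x + eval_poly G x"
proof -
  let ?A = "Poly_Mapping.keys F \<union> Poly_Mapping.keys G"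
  have "Poly_Mapping.keys (F + G) \<subseteq> ?A" by (rule Poly_Mapping.keys_add)
  then show ?thesis
    by (simp add: eval_poly_superset[of ?A] lookup_add distrib_right sum.distrib)
qed

lemma eval_poly_sum: "eval_poly (\<Sum>i\<in>I. f i) x = (\<Sum>i\<in>I. eval_poly (f i) x)"
  by (induction I rule: infinite_finite_induct) (simp_all add: eval_poly_add)

abbreviation unit_exponent :: "'n \<Rightarrow> 'n \<Rightarrow>\<^sub>0 nat" where
  "unit_exponent i \<equiv> Poly_Mapping.single i 1"

lemma exponent_split:
  fixes m :: "'n::finite \<Rightarrow>\<^sub>0 nat"
  assumes "(\<Sum>i\<in>UNIV. Poly_Mapping.lookup m i) = Suc d"
  shows "\<exists>i m'. m = unit_exponent i + m' \<and> (\<Sum>i\<in>UNIV. Poly_Mapping.lookup m' i) = d"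
proof -
  from assms obtain i where i: "Poly_Mapping.lookup m i \<noteq> 0"
    by (metis Zero_not_Suc sum.neutral)
  have m: "m = unit_exponent i + (m - unit_exponent i)"
    by (rule poly_mapping_eqI) (use i in \<open>auto simp: lookup_add lookup_minus lookup_single when_def\<close>)
  have "Suc d = (\<Sum>j\<in>UNIV. Poly_Mapping.lookup (unit_exponent i) j) + (\<Sum>j\<in>UNIV. Poly_Mapping.lookup (m - unit_exponent i) j)"
    using assms by (subst (asm) m) (simp add: lookup_add sum.distrib)
  moreover have "(\<Sum>j\<in>UNIV. Poly_Mapping.lookup (unit_exponent i) j) = 1"
    by (simp add: lookup_single when_def)
  ultimately show ?thesis using m by (metis Suc_eq_plus1 add.commute add_right_imp_eq)
qed

lemma cubic_exponent:
  fixes m :: "'n::finite \<Rightarrow>\<^sub>0 nat"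
  assumes "(\<Sum>i\<in>UNIV. Poly_Mapping.lookup m i) = 3"
  shows "\<exists>i j k. m = unit_exponent i + unit_exponent j + unit_exponent k"
proof -
  from exponent_split[of m 2] assms obtain i m1 where 1: "m = unit_exponent i + m1" "(\<Sum>i\<in>UNIV. Poly_Mapping.lookup m1 i) = 2"
    by (auto simp: numeral_3_eq_3)
  from exponent_split[of m1 1] 1 obtain j m2 where 2: "m1 = unit_exponent j + m2" "(\<Sum>i\<in>UNIV. Poly_Mapping.lookup m2 i) = 1"
    by (auto simp: numeral_2_eq_2)
  from exponent_split[of m2 0] 2 obtain k m3 where 3: "m2 = unit_exponent k + m3" "(\<Sum>i\<in>UNIV. Poly_Mapping.lookup m3 i) = 0"
    by auto
  from 3(2) have "m3 = 0" by (intro poly_mapping_eqI) simp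
  with 1 2 3 show ?thesis by (auto simp: add.assoc)
qed

text \<open>The polarization of the monomial \<open>x\<^sub>i x\<^sub>j x\<^sub>k\<close>, in which indices may coincide.\<close>

definition monom_form :: "'n::finite \<Rightarrow> 'n \<Rightarrow> 'n \<Rightarrow> complex^'n \<Rightarrow> complex^'n \<Rightarrow> complex^'n \<Rightarrow> complex" where
  "monom_form i j k x y z =
     (x$i * y$j * z$k + x$i * y$k * z$j + x$j * y$i * z$k + x$j * y$k * z$i
      + x$k * y$i * z$j + x$k * y$j * z$i) / 6"

lemma cubic_form_monom_form: "cubic_form (monom_form i j k)"
  by unfold_locales (simp_all add: monom_form_def algebra_simps add_divide_distrib)

lemma cubic_form_lincomb:
  assumes "finite A" "\<And>m. m \<in> A \<Longrightarrow> cubic_form (T m)"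
  shows "cubic_form (\<lambda>x y z. \<Sum>m\<in>A. c m * T m x y z)"
proof -
  have "T m x y z = T m y x z" "T m x y z = T m x z y" "T m (x + x') y z = T m x y z + T m x' y z"
    "T m (r *s x) y z = r * T m x y z" if "m \<in> A" for m x x' y z r
    using assms(2)[OF that] unfolding cubic_form_def by blast+
  then show ?thesis
    by unfold_locales
      (auto simp: sum_distrib_left distrib_left mult.left_commute simp flip: sum.distrib intro!: sum.cong)
qed

lemma prod_power_add:
  "(\<Prod>n\<in>UNIV. (x $ n) ^ Poly_Mapping.lookup (m + m') n)
    = (\<Prod>n\<in>UNIV. (x $ n) ^ Poly_Mapping.lookup m n) * (\<Prod>n\<in>UNIV. (x $ n) ^ Poly_Mapping.lookup m' n)"
  for x :: "complex^'n::finite"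
  by (simp add: lookup_add power_add prod.distrib)

lemma prod_power_var:
  "(\<Prod>n\<in>UNIV. (x $ n) ^ Poly_Mapping.lookup (unit_exponent i) n) = x $ i" for x :: "complex^'n::finite"
proof -
  have "(\<Prod>n\<in>UNIV. (x $ n) ^ Poly_Mapping.lookup (unit_exponent i) n) = (\<Prod>n\<in>UNIV. if i = n then x $ n else 1)"
    by (rule prod.cong) (auto simp: lookup_single when_def)
  then show ?thesis by simp
qed

lemma monom_derivative:
  fixes x :: "complex^'n::finite"
  defines "M \<equiv> \<lambda>m. \<Prod>n\<in>UNIV. (x $ n) ^ Poly_Mapping.lookup m n"
  assumes m: "m = unit_exponent i + unit_exponent j + unit_exponent k"
  shows "of_nat (Poly_Mapping.lookup m l) * M (m - unit_exponent l) = 3 * monom_form i j k x x (axis l 1)"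
proof -
  have M: "M (unit_exponent a + unit_exponent b) = x $ a * x $ b" for a b
    by (simp only: M_def prod_power_add prod_power_var)
  have sub: "m - unit_exponent i = unit_exponent j + unit_exponent k" "m - unit_exponent j = unit_exponent i + unit_exponent k"
    "m - unit_exponent k = unit_exponent i + unit_exponent j"
    unfolding m by (metis add_diff_cancel_left' add.assoc add.commute)+
  have l: "Poly_Mapping.lookup m l = (if l = i then 1 else 0) + (if l = j then 1 else 0) + (if l = k then 1 else 0)"
    unfolding m by (auto simp: lookup_add lookup_single when_def)
  show ?thesis
    unfolding l monom_form_def axis_def vec_lambda_beta
    by (cases "l = i"; cases "l = j"; cases "l = k"; simp add: sub sub[unfolded One_nat_def] M M[unfolded One_nat_def])
qed

text \<open>After this lemma coefficients of polynomials no longer occur; everything below works with \<open>T\<close>.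
The formal partial derivatives are included because the Jacobian criterion refers to them.\<close>

lemma cubic_polarization:
  fixes F :: "'n::finite cpoly"
  assumes "homogeneous 3 F"
  shows "\<exists>T. cubic_form T \<and> (\<forall>x. eval_poly F x = T x x x)
    \<and> (\<forall>l x. eval_poly (partial_deriv l F) x = 3 * T x x (axis l 1))"
proof -
  have "\<exists>i j k. m = unit_exponent i + unit_exponent j + unit_exponent k" if "m \<in> Poly_Mapping.keys F" for m
    using that assms by (intro cubic_exponent) (auto simp: homogeneous_def)
  then obtain i j k where ijk: "\<And>m. m \<in> Poly_Mapping.keys F \<Longrightarrow> m = unit_exponent (i m) + unit_exponent (j m) + unit_exponent (k m)"
    by metis
  define T where "T x y z = (\<Sum>m\<in>Poly_Mapping.keys F. Poly_Mapping.lookup F m * monom_form (i m) (j m) (k m) x y z)" for x y z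
  have "cubic_form T"
    unfolding T_def by (rule cubic_form_lincomb) (auto intro: cubic_form_monom_form)
  moreover have "eval_poly F x = T x x x" for x
    unfolding eval_poly_def T_def
  proof (rule sum.cong)
    fix m assume "m \<in> Poly_Mapping.keys F"
    note m = ijk[OF this]
    have "(\<Prod>n\<in>UNIV. (x $ n) ^ Poly_Mapping.lookup m n) = x $ i m * x $ j m * x $ k m"
      by (subst m) (simp only: prod_power_add prod_power_var)
    then show "Poly_Mapping.lookup F m * (\<Prod>n\<in>UNIV. (x $ n) ^ Poly_Mapping.lookup m n)
      = Poly_Mapping.lookup F m * monom_form (i m) (j m) (k m) x x x"
      by (simp add: monom_form_def)
  qed simp
  moreover have "eval_poly (partial_deriv l F) x = 3 * T x x (axis l 1)" for l x
    unfolding partial_deriv_def eval_poly_sum T_def sum_distrib_left eval_poly_single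
  proof (rule sum.cong)
    fix m assume "m \<in> Poly_Mapping.keys F"
    note m = ijk[OF this]
    show "of_nat (Poly_Mapping.lookup m l) * Poly_Mapping.lookup F m *
        (\<Prod>n\<in>UNIV. (x $ n) ^ Poly_Mapping.lookup (m - unit_exponent l) n)
      = 3 * (Poly_Mapping.lookup F m * monom_form (i m) (j m) (k m) x x (axis l 1))"
      using monom_derivative[OF m, where x = x and l = l] by (simp add: mult.assoc mult.left_commute)
  qed simp
  ultimately show ?thesis by blast
qed

section \<open>Polynomial functions on lines, and cubics in one variable\<close>

text \<open>Restriction to lines is a substitute for polynomials in several variables: it is enough to show that
two functions of this kind which are not identically zero are nonzero at a common point.\<close>

definition poly_on_lines :: "(complex^'n::finite \<Rightarrow> complex) \<Rightarrow> bool" where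
  "poly_on_lines f \<longleftrightarrow> (\<forall>x y. \<exists>p. \<forall>t. f (x + t *s y) = poly p t)"

lemma poly_on_lines_const: "poly_on_lines (\<lambda>x. c)"
  unfolding poly_on_lines_def by (intro allI exI[of _ "[:c:]"]) simp

lemma poly_on_lines_add:
  assumes "poly_on_lines f" "poly_on_lines g" shows "poly_on_lines (\<lambda>x. f x + g x)"
  using assms unfolding poly_on_lines_def by (metis poly_add)

lemma poly_on_lines_diff:
  assumes "poly_on_lines f" "poly_on_lines g" shows "poly_on_lines (\<lambda>x. f x - g x)"
  using assms unfolding poly_on_lines_def by (metis poly_diff)

lemma poly_on_lines_mult:
  assumes "poly_on_lines f" "poly_on_lines g" shows "poly_on_lines (\<lambda>x. f x * g x)"
  using assms unfolding poly_on_lines_def by (metis poly_mult)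

lemma poly_on_lines_power:
  assumes "poly_on_lines f" shows "poly_on_lines (\<lambda>x. f x ^ n)"
  by (induction n) (simp_all add: poly_on_lines_const poly_on_lines_mult assms)

lemmas poly_on_lines_intros = poly_on_lines_const poly_on_lines_add poly_on_lines_diff
  poly_on_lines_mult poly_on_lines_power

text \<open>On the line through \<open>u\<close> and \<open>v\<close> both functions are nonzero polynomials in one variable, so their product
does not vanish identically.\<close>

lemma poly_on_lines_common_nonzero:
  assumes "poly_on_lines f" "poly_on_lines g" "f u \<noteq> 0" "g v \<noteq> 0"
  shows "\<exists>w. f w \<noteq> 0 \<and> g w \<noteq> 0"
proof -
  obtain p q where p: "\<And>t. f (u + t *s (v - u)) = poly p t" and q: "\<And>t. g (u + t *s (v - u)) = poly q t"
    using assms(1,2) unfolding poly_on_lines_def by metis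
  have "poly p 0 \<noteq> 0" "poly q 1 \<noteq> 0" using assms(3,4) by (simp_all flip: p q)
  then have "p * q \<noteq> 0" by auto
  then obtain t where "poly (p * q) t \<noteq> 0" by (meson poly_all_0_iff_0)
  then show ?thesis by (metis p q mult_eq_0_iff poly_mult)
qed

context cubic_form
begin

lemma poly_on_lines_cubic: "poly_on_lines (\<lambda>x. T x x x)"
  unfolding poly_on_lines_def
proof (intro allI)
  fix x y
  show "\<exists>p. \<forall>t. T (x + t *s y) (x + t *s y) (x + t *s y) = poly p t"
    by (rule exI[of _ "[:T x x x, 3 * T x x y, 3 * T x y y, T y y y:]"])
      (simp add: value_on_line algebra_simps power2_eq_square power3_eq_cube)
qed

lemma poly_on_lines_quadratic: "poly_on_lines (\<lambda>x. T x x e)"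
  unfolding poly_on_lines_def
proof (intro allI)
  fix x y
  have "T y x e = T x y e" by (rule swap12)
  then show "\<exists>p. \<forall>t. T (x + t *s y) (x + t *s y) e = poly p t"
    by (intro exI[of _ "[:T x x e, 2 * T x y e, T y y e:]"])
      (simp add: add1 add2 scale1 scale2 algebra_simps power2_eq_square)
qed

lemma poly_on_lines_linear: "poly_on_lines (\<lambda>x. T x e e')"
  unfolding poly_on_lines_def
proof (intro allI)
  fix x y
  show "\<exists>p. \<forall>t. T (x + t *s y) e e' = poly p t"
    by (intro exI[of _ "[:T x e e', T y e e':]"]) (simp add: add1 scale1)
qed

lemma poly_on_lines_quadratic': "poly_on_lines (\<lambda>x. T e x x)"
  using poly_on_lines_quadratic[of e] by (metis (no_types, lifting) ext swap12 swap23)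

lemma poly_on_lines_linear': "poly_on_lines (\<lambda>x. T e e' x)"
  using poly_on_lines_linear[of e e'] by (metis (no_types, lifting) ext swap12 swap23)

end

lemma quadratic_splits:
  fixes a b c :: complex
  assumes "a \<noteq> 0"
  shows "\<exists>r s. b = - a * (r + s) \<and> c = a * r * s"
proof -
  define d where "d = csqrt (b^2 - 4 * a * c)"
  have d: "d^2 = b^2 - 4 * a * c" by (simp add: d_def)
  have "a * ((- b + d) / (2 * a)) * ((- b - d) / (2 * a)) = (b^2 - d^2) / (4 * a)"
    using assms by (simp add: field_simps power2_eq_square)
  also have "\<dots> = c" using assms by (simp add: d)
  finally show ?thesis
    using assms by (intro exI[of _ "(- b + d) / (2 * a)"] exI[of _ "(- b - d) / (2 * a)"])
      (simp add: field_simps)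
qed

lemma cubic_root_exists:
  fixes a b c d :: complex
  assumes "a \<noteq> 0"
  shows "\<exists>r. a * r^3 + b * r^2 + c * r + d = 0"
proof -
  have "degree [:d, c, b, a:] > 0"
    using assms by simp
  from alg_closed_imp_poly_has_root[OF this] obtain r where "poly [:d, c, b, a:] r = 0" ..
  then have "a * r^3 + b * r^2 + c * r + d = 0"
    by (simp add: power2_eq_square power3_eq_cube ring_distribs ac_simps)
  then show ?thesis ..
qed

lemma cubic_splits:
  fixes a b c d :: complex
  assumes "a \<noteq> 0"
  shows "\<exists>r s t. b = - a * (r + s + t) \<and> c = a * (r * s + r * t + s * t) \<and> d = - a * r * s * t"
proof -
  obtain r where r: "a * r^3 + b * r^2 + c * r + d = 0"
    using cubic_root_exists[OF assms] by blast
  obtain s t where "b + a * r = - a * (s + t)" and q: "c + b * r + a * r^2 = a * s * t"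
    using quadratic_splits[OF assms] by blast
  then have b: "b = - a * (r + s + t)" by Groebner_Basis.algebra
  have c: "c = a * (r * s + r * t + s * t)" using q unfolding b by Groebner_Basis.algebra
  have "d = - a * r * s * t" using r unfolding b c by Groebner_Basis.algebra
  with b c show ?thesis by blast
qed

text \<open>The discriminant of \<open>a z\<^sup>3 + b z\<^sup>2 + c z + d\<close>. It is needed as a polynomial in the coefficients, since
these will depend on a point.\<close>

definition cubic_disc :: "complex \<Rightarrow> complex \<Rightarrow> complex \<Rightarrow> complex \<Rightarrow> complex" where
  "cubic_disc a b c d = b^2 * c^2 - 4 * a * c^3 - 4 * b^3 * d - 27 * a^2 * d^2 + 18 * a * b * c * d"

lemma cubic_disc_scale: "cubic_disc a (a * b) (a * c) (a * d) = a^4 * cubic_disc 1 b c d"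
  by (simp add: cubic_disc_def power2_eq_square power3_eq_cube power4_eq_xxxx algebra_simps)

lemma cubic_disc_roots:
  "cubic_disc 1 (- (r + s + t)) (r * s + r * t + s * t) (- (r * s * t)) = ((r - s) * (r - t) * (s - t))^2"
  by (simp add: cubic_disc_def power2_eq_square power3_eq_cube algebra_simps)

lemma cubic_three_roots:
  assumes "a \<noteq> 0" "cubic_disc a b c d \<noteq> 0"
  shows "\<exists>r s t. r \<noteq> s \<and> r \<noteq> t \<and> s \<noteq> t \<and> (\<forall>z\<in>{r, s, t}. a * z^3 + b * z^2 + c * z + d = 0)"
proof -
  obtain r s t where "b = - a * (r + s + t)" "c = a * (r * s + r * t + s * t)" "d = - a * r * s * t"
    using cubic_splits[OF assms(1)] by blast
  then have rst: "b = a * (- (r + s + t))" "c = a * (r * s + r * t + s * t)" "d = a * (- (r * s * t))"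
    by (simp_all only: mult_minus_left mult_minus_right mult.assoc)
  have "r \<noteq> s \<and> r \<noteq> t \<and> s \<noteq> t"
    using assms(2) unfolding rst cubic_disc_scale cubic_disc_roots by auto
  moreover have "a * z^3 + b * z^2 + c * z + d = 0" if "z \<in> {r, s, t}" for z
  proof -
    have "a * z^3 + b * z^2 + c * z + d = a * (z - r) * (z - s) * (z - t)"
      unfolding rst by (simp add: power2_eq_square power3_eq_cube algebra_simps)
    with that show ?thesis by auto
  qed
  ultimately show ?thesis by blast
qed

lemma quadratic_three_roots:
  fixes a b c :: "'a::idom"
  assumes "r \<noteq> s" "r \<noteq> t" "s \<noteq> t" "\<And>z. z \<in> {r, s, t} \<Longrightarrow> a * z^2 + b * z + c = 0"
  shows "c = 0"
proof -
  have "a * r^2 + b * r + c = 0" "a * s^2 + b * s + c = 0" "a * t^2 + b * t + c = 0"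
    using assms(4) by auto
  then have "(r - s) * (a * (r + s) + b) = 0" "(r - t) * (a * (r + t) + b) = 0"
    by Groebner_Basis.algebra+
  then have *: "a * (r + s) + b = 0" "a * (r + t) + b = 0" using assms by simp_all
  then have "a * (s - t) = 0" by Groebner_Basis.algebra
  then have "a = 0" using assms by simp
  with * show ?thesis using assms(4)[of r] by simp
qed

lemma common_zero_two_functionals:
  fixes f g :: "complex^4"
  shows "\<exists>y. y \<noteq> 0 \<and> (\<Sum>i\<in>UNIV. f $ i * y $ i) = 0 \<and> (\<Sum>i\<in>UNIV. g $ i * y $ i) = 0"
proof -
  define A :: "complex^4^4" where "A = (\<chi> i. if i = 1 then f else if i = 2 then g else 0)"
  have "row 3 A = 0" by (simp add: row_def A_def vec_eq_iff)
  then have "det A = 0" by (rule det_zero_row)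
  then have "\<not> (\<exists>B. B ** A = mat 1)" by (metis det_I det_mul mult_zero_right zero_neq_one)
  then obtain y where y: "A *v y = 0" "y \<noteq> 0" by (auto simp: matrix_left_invertible_ker)
  have "(A *v y) $ 1 = 0" "(A *v y) $ 2 = 0" using y by simp_all
  with y(2) show ?thesis by (auto simp: matrix_vector_mult_def A_def)
qed

lemma cubic_coeffs_zero:
  fixes a b c d :: complex
  assumes "\<And>s. s \<noteq> 0 \<Longrightarrow> a + b * s + c * s^2 + d * s^3 = 0"
  shows "a = 0" "b = 0" "c = 0" "d = 0"
proof -
  have 1: "a + b + c + d = 0" "a - b + c - d = 0"
    "a + 2 * b + 4 * c + 8 * d = 0" "a - 2 * b + 4 * c - 8 * d = 0"
    using assms[of 1] assms[of "-1"] assms[of 2] assms[of "-2"] by (simp_all add: algebra_simps)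
  have "3 * a = 0" using 1 by Groebner_Basis.algebra
  moreover have "6 * b = 0" using 1 by Groebner_Basis.algebra
  moreover have "3 * c = 0" using 1 by Groebner_Basis.algebra
  moreover have "6 * d = 0" using 1 by Groebner_Basis.algebra
  ultimately show "a = 0" "b = 0" "c = 0" "d = 0" by simp_all
qed

section \<open>A smooth cubic form is determined by its zero set\<close>

text \<open>The argument works with the projection of the surface from one of its points \<open>x\<close>. On the line
\<open>x + t y\<close> the form is \<open>t (L + t Q + t\<^sup>2 F)\<close> with \<open>L = 3 T x x y\<close>, \<open>Q = 3 T x y y\<close>,
\<open>F = T y y y\<close>, so the line meets the surface in three distinct points if \<open>L\<close>, \<open>F\<close> and
\<open>Q\<^sup>2 - 4 L F\<close> do not vanish.\<close>

locale smooth_cubic_form = cubic_form T for T :: "complex^4 \<Rightarrow> complex^4 \<Rightarrow> complex^4 \<Rightarrow> complex" +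
  assumes smooth: "x \<noteq> 0 \<Longrightarrow> T x x x = 0 \<Longrightarrow> \<exists>y. T x x y \<noteq> 0"
begin

lemma exists_zero: "\<exists>x. x \<noteq> 0 \<and> T x x x = 0"
proof (cases "T (axis 1 1) (axis 1 1) (axis 1 1) = 0")
  case True
  then show ?thesis by (intro exI[of _ "axis 1 1"]) (simp add: axis_eq_0_iff)
next
  case False
  let ?a = "axis 1 1 :: complex^4" and ?b = "axis 2 1 :: complex^4"
  obtain t where t: "T ?a ?a ?a * t^3 + 3 * T ?b ?a ?a * t^2 + 3 * T ?b ?b ?a * t + T ?b ?b ?b = 0"
    using cubic_root_exists[OF False] by blast
  have "?b + t *s ?a \<noteq> 0"
  proof
    assume "?b + t *s ?a = 0"
    then have "(?b + t *s ?a) $ 2 = 0" by simp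
    then show False by (simp add: axis_def)
  qed
  moreover have "T (?b + t *s ?a) (?b + t *s ?a) (?b + t *s ?a) = 0"
    using t by (simp add: value_on_line algebra_simps)
  ultimately show ?thesis by blast
qed

lemma T_expand: "T u v y = (\<Sum>i\<in>UNIV. T u v (axis i 1) * y $ i)"
  by (subst basis_expansion[of y, symmetric]) (simp add: sum3 scale3 mult.commute)

text \<open>If \<open>Q\<^sup>2 = 4 L F\<close> identically, then \<open>L\<close> divides \<open>Q\<close>, say \<open>Q = L M\<close>, and \<open>F = L M\<^sup>2 / 4\<close> is
singular where \<open>L = M = 0\<close>. The proof finds such a point by two linear conditions, with \<open>w\<close>
a vector outside the kernel of \<open>L\<close>, and checks the vanishing of the derivative separately on the kernel of
\<open>L\<close> and in direction \<open>w\<close> by comparing coefficients of powers of \<open>s\<close> along \<open>v + s w\<close>.\<close>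

lemma projection_not_square:
  assumes x: "x \<noteq> 0" "T x x x = 0"
  shows "\<exists>y. (3 * T x y y)^2 - 4 * (3 * T x x y) * T y y y \<noteq> 0"
proof (rule ccontr)
  assume "\<not> ?thesis"
  then have "(3 * T x y y)^2 - 4 * (3 * T x x y) * T y y y = 0" for y by blast
  then have D: "(3 * T x y y)^2 = 4 * (3 * T x x y) * T y y y" for y by (simp only: right_minus_eq)
  obtain w where w: "T x x w \<noteq> 0" using smooth[OF x] by blast
  \<comment> \<open>On the kernel of \<open>L\<close> the linear form \<open>M\<close> is \<open>2 T x w h / T x x w\<close>, so \<open>y\<close> is a common zero of \<open>L\<close> and \<open>M\<close>.\<close>
  obtain y where y: "y \<noteq> 0" "T x x y = 0" "T x w y = 0"
  proof -
    obtain y where y: "y \<noteq> 0" "(\<Sum>i\<in>UNIV. T x x (axis i 1) * y $ i) = 0"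
        "(\<Sum>i\<in>UNIV. T x w (axis i 1) * y $ i) = 0"
      using common_zero_two_functionals[of "\<chi> i. T x x (axis i 1)" "\<chi> i. T x w (axis i 1)"] by auto
    show thesis
      by (rule that[OF y(1)]) (use y(2,3) in \<open>simp_all only: T_expand[of x _ y]\<close>)
  qed
  have Q: "T x h h = 0" if "T x x h = 0" for h
    using D[of h] that by simp
  define W m n where "W = T x x w" and "m h = T x h w" and "n = T x w w" for h
  have key: "T y y y = 0 \<and> T y y h = 0 \<and> T y y w = 0" if h: "T x x h = 0" for h
  proof -
    \<comment> \<open>The quadratic form \<open>Q\<close> vanishes on the kernel of \<open>L\<close>, and so does its polarization.\<close>
    have Q2: "T x a b = 0" if "T x x a = 0" "T x x b = 0" for a b
    proof -
      have "T x (a + b) (a + b) = 0" using that by (intro Q) (simp add: add3)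
      then show ?thesis using Q[OF that(1)] Q[OF that(2)] swap23[of x b a] by (simp add: add2 add3)
    qed
    have line: "4 * W * T (y + e *s h) (y + e *s h) (y + e *s h) = 0 \<and>
       12 * W * T (y + e *s h) (y + e *s h) w = 12 * e^2 * m h^2" for e
    proof -
      define v where "v = y + e *s h"
      have v: "T x x v = 0" using h y by (simp add: v_def add3 scale3)
      have v': "T x v w = e * m h"
        using y swap23[of x w y] by (simp add: v_def add2 scale2 m_def)
      have "4 * W * T v v v + (12 * W * T v v w - 12 * e^2 * m h^2) * s
        + (12 * W * T v w w - 12 * e * m h * n) * s^2 + (4 * W * T w w w - 3 * n^2) * s^3 = 0"
        if "s \<noteq> 0" for s
      proof -
        have "T x x (v + s *s w) = s * W" using v by (simp add: add3 scale3 W_def)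
        moreover have "T x (v + s *s w) (v + s *s w) = s * (2 * e * m h + s * n)"
          using Q[OF v] v' swap23[of x w v]
          by (simp add: add2 add3 scale2 scale3 n_def algebra_simps)
        ultimately have "(3 * (s * (2 * e * m h + s * n)))^2 =
            4 * (3 * (s * W)) * (T v v v + 3 * s * T v v w + 3 * s^2 * T v w w + s^3 * T w w w)"
          using D[of "v + s *s w"] by (simp only: value_on_line)
        then have "s * (4 * W * T v v v + (12 * W * T v v w - 12 * e^2 * m h^2) * s
          + (12 * W * T v w w - 12 * e * m h * n) * s^2 + (4 * W * T w w w - 3 * n^2) * s^3) = 0"
          by Groebner_Basis.algebra
        then show ?thesis using that by simp
      qed
      from cubic_coeffs_zero(1,2)[OF this] show ?thesis by (simp add: v_def)
    qed
    have W: "W \<noteq> 0" using w by (simp add: W_def)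
    have "T y y y + (3 * T y y h) * e + (3 * T y h h) * e^2 + T h h h * e^3 = 0" for e
    proof -
      have "T (y + e *s h) (y + e *s h) (y + e *s h) = 0" using line[of e] W by simp
      then show ?thesis by (simp add: value_on_line mult.commute mult.left_commute)
    qed
    from cubic_coeffs_zero(1,2)[OF this] line[of 0] W show ?thesis by simp
  qed
  have "T y y z = 0" for z
  proof -
    define h where "h = z - (T x x z / W) *s w"
    have z: "z = h + (T x x z / W) *s w" by (simp add: h_def)
    have "T x x z = T x x h + T x x z / W * W" by (subst z) (simp only: add3 scale3 W_def)
    then have "T x x h = 0" using w by (simp add: W_def)
    from key[OF this] show ?thesis by (subst z) (simp add: add3 scale3)
  qed
  moreover have "T y y y = 0" using key[of 0] by simp
  ultimately show False using smooth[OF y(1)] by blast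
qed

text \<open>Fix a direction \<open>e\<close> such that the line \<open>x + t e\<close> meets the zero set of \<open>T\<close> in three points
for one \<open>x\<close>, hence for generic \<open>x\<close>. On such a line both forms are cubic polynomials in \<open>t\<close>,
and \<open>S\<close> vanishes at the three roots of \<open>T\<close>, so they are proportional. The factor is the quotient \<open>k\<close>
of the leading coefficients, which does not depend on \<open>x\<close>. So \<open>S = k T\<close> generically, and therefore everywhere.\<close>

lemma vanishing_cubic_proportional:
  assumes "cubic_form S" "\<And>x. T x x x = 0 \<Longrightarrow> S x x x = 0"
  shows "\<exists>k. \<forall>x. S x x x = k * T x x x"
proof -
  interpret S: cubic_form S by fact
  obtain x0 where x0: "x0 \<noteq> 0" "T x0 x0 x0 = 0" using exists_zero by blast
  obtain w where w: "T x0 x0 w \<noteq> 0" using smooth[OF x0] by blast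
  obtain u where u: "T u u u \<noteq> 0"
    using polarization[of x0 x0 w] w by fastforce
  obtain v where v: "(3 * T x0 v v)^2 - 4 * (3 * T x0 x0 v) * T v v v \<noteq> 0"
    using projection_not_square[OF x0] by blast
  obtain e0 where "T e0 e0 e0 \<noteq> 0" "T x0 x0 e0 \<noteq> 0"
    using poly_on_lines_common_nonzero[OF poly_on_lines_cubic poly_on_lines_linear' u w] by blast
  then have e0: "T e0 e0 e0 * T x0 x0 e0 \<noteq> 0" by simp
  have "\<exists>e. T e e e * T x0 x0 e \<noteq> 0 \<and> (3 * T x0 e e)^2 - 4 * (3 * T x0 x0 e) * T e e e \<noteq> 0"
    by (rule poly_on_lines_common_nonzero[where f = "\<lambda>e. T e e e * T x0 x0 e"
          and g = "\<lambda>e. (3 * T x0 e e)^2 - 4 * (3 * T x0 x0 e) * T e e e", OF _ _ e0 v])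
      (intro poly_on_lines_intros poly_on_lines_cubic poly_on_lines_linear' poly_on_lines_quadratic')+
  then obtain e where e: "T e e e \<noteq> 0" "T x0 x0 e \<noteq> 0"
    "(3 * T x0 e e)^2 - 4 * (3 * T x0 x0 e) * T e e e \<noteq> 0" by auto
  define disc where "disc x = cubic_disc (T e e e) (3 * T x e e) (3 * T x x e) (T x x x)" for x
  define k where "k = S e e e / T e e e"
  have good: "S x x x = k * T x x x" if disc: "disc x \<noteq> 0" for x
  proof -
    obtain r s t where rst: "r \<noteq> s" "r \<noteq> t" "s \<noteq> t"
      and root: "\<And>z. z \<in> {r, s, t} \<Longrightarrow> T e e e * z^3 + 3 * T x e e * z^2 + 3 * T x x e * z + T x x x = 0"
      using cubic_three_roots[OF e(1) disc[unfolded disc_def]] by blast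
    \<comment> \<open>The choice of \<open>k\<close> cancels the leading terms, leaving a quadratic polynomial with three roots.\<close>
    have "(3 * S x e e - k * (3 * T x e e)) * z^2 + (3 * S x x e - k * (3 * T x x e)) * z + (S x x x - k * T x x x) = 0"
      if "z \<in> {r, s, t}" for z
    proof -
      have "T (x + z *s e) (x + z *s e) (x + z *s e) = 0"
        using root[OF that] by (simp add: value_on_line ac_simps)
      from assms(2)[OF this] have "S e e e * z^3 + 3 * S x e e * z^2 + 3 * S x x e * z + S x x x = 0"
        by (simp add: S.value_on_line ac_simps)
      moreover have "S e e e = k * T e e e" using e(1) by (simp add: k_def)
      ultimately show ?thesis using root[OF that] by Groebner_Basis.algebra
    qed
    from quadratic_three_roots[OF rst this] show ?thesis by simp
  qed
  have disc0: "disc x0 \<noteq> 0"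
  proof -
    have "disc x0 = (3 * T x0 x0 e)^2 * ((3 * T x0 e e)^2 - 4 * (3 * T x0 x0 e) * T e e e)"
      unfolding disc_def cubic_disc_def x0(2)
      by (simp add: power2_eq_square power3_eq_cube algebra_simps)
    with e show ?thesis by simp
  qed
  have "S x x x - k * T x x x = 0" for x
  proof (rule ccontr)
    assume "S x x x - k * T x x x \<noteq> 0"
    moreover have "poly_on_lines (\<lambda>x. S x x x - k * T x x x)"
      by (intro poly_on_lines_intros poly_on_lines_cubic S.poly_on_lines_cubic)
    moreover have "poly_on_lines disc"
      unfolding disc_def cubic_disc_def
      by (intro poly_on_lines_intros poly_on_lines_cubic poly_on_lines_linear poly_on_lines_quadratic)
    ultimately have "\<exists>w. S w w w - k * T w w w \<noteq> 0 \<and> disc w \<noteq> 0"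
      using disc0 by (intro poly_on_lines_common_nonzero)
    then show False using good by auto
  qed
  then show ?thesis by auto
qed

end

section \<open>Symmetric cubic forms\<close>

lemma perm_vec_nth [simp]: "perm_vec \<sigma> x $ i = x $ inv_into UNIV \<sigma> i"
  by (simp add: perm_vec_def)

lemma perm_vec_add: "perm_vec \<sigma> (x + y) = perm_vec \<sigma> x + perm_vec \<sigma> y"
  and perm_vec_scale: "perm_vec \<sigma> (c *s x) = c *s perm_vec \<sigma> x"
  and perm_vec_zero: "perm_vec \<sigma> 0 = 0"
  by (simp_all add: vec_eq_iff)

lemma perm_vec_comp:
  assumes "bij \<sigma>" "bij \<tau>"
  shows "perm_vec \<sigma> (perm_vec \<tau> x) = perm_vec (\<sigma> \<circ> \<tau>) x"
  using assms by (simp add: vec_eq_iff o_inv_distrib)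

lemma perm_vec_id [simp]: "perm_vec id x = x"
  by (simp add: vec_eq_iff)

lemma perm_vec_inv [simp]:
  assumes "bij \<sigma>"
  shows "perm_vec \<sigma> (perm_vec (inv_into UNIV \<sigma>) x) = x" "perm_vec (inv_into UNIV \<sigma>) (perm_vec \<sigma> x) = x"
  using assms by (simp_all add: vec_eq_iff inv_inv_eq bij_is_surj bij_is_inj surj_f_inv_f)

lemma perm_vec_axis:
  assumes "bij \<sigma>"
  shows "perm_vec \<sigma> (axis i c) = axis (\<sigma> i) c"
proof -
  have "inv_into UNIV \<sigma> j = i \<longleftrightarrow> j = \<sigma> i" for j
    using bij_inv_eq_iff[OF assms, of i j] by auto
  then show ?thesis by (simp add: vec_eq_iff axis_def)
qed

lemma perm_vec_eq_0_iff:
  assumes "bij \<sigma>" shows "perm_vec \<sigma> x = 0 \<longleftrightarrow> x = 0"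
  by (metis assms perm_vec_inv(2) perm_vec_zero)

lemma cubic_form_perm:
  assumes "cubic_form T"
  shows "cubic_form (\<lambda>x y z. T (perm_vec \<sigma> x) (perm_vec \<sigma> y) (perm_vec \<sigma> z))"
proof -
  interpret cubic_form T by fact
  show ?thesis
    by unfold_locales (rule swap12 swap23, simp_all add: perm_vec_add perm_vec_scale add1 scale1 swap23)
qed

lemma cubic_form_diagonal_proportional:
  assumes "cubic_form S" "cubic_form T" "\<And>x. S x x x = k * T x x x"
  shows "S x y z = k * T x y z"
proof -
  have "6 * S x y z = 6 * (k * T x y z)"
    unfolding cubic_form.polarization[OF assms(1)] assms(3) mult.left_commute[of 6]
      cubic_form.polarization[OF assms(2)]
    by (simp add: algebra_simps)
  then show ?thesis by simp
qed

lemma cubic_form_eq_on_basis: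
  fixes S T :: "complex^4 \<Rightarrow> complex^4 \<Rightarrow> complex^4 \<Rightarrow> complex"
  assumes "cubic_form S" "cubic_form T"
    and eq: "\<And>i j k. S (axis i 1) (axis j 1) (axis k 1) = T (axis i 1) (axis j 1) (axis k 1)"
  shows "S x y z = T x y z"
proof -
  interpret S: cubic_form S by fact
  interpret T: cubic_form T by fact
  note axes = basis_expansion[symmetric]
  have 3: "S u v w = T u v w" if "\<And>k. S u v (axis k 1) = T u v (axis k 1)" for u v w
    by (subst (1 2) axes[of w]) (simp add: S.sum3 T.sum3 S.scale3 T.scale3 that)
  have 1: "S (axis i 1) (axis j 1) z = T (axis i 1) (axis j 1) z" for i j z
    by (rule 3) (rule eq)
  have 2: "S (axis i 1) y z = T (axis i 1) y z" for i y z
    by (rule 3) (simp only: S.swap23[of "axis i 1" y] T.swap23[of "axis i 1" y] 1)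
  show ?thesis
  proof (rule 3)
    fix k
    show "S x y (axis k 1) = T x y (axis k 1)"
      using 2[of k x y] S.swap23[of x y "axis k 1"] S.swap12[of x "axis k 1" y]
        T.swap23[of x y "axis k 1"] T.swap12[of x "axis k 1" y] by simp
  qed
qed

definition psum :: "nat \<Rightarrow> complex^4 \<Rightarrow> complex" where
  "psum d x = (\<Sum>i\<in>UNIV. (x $ i) ^ d)"

text \<open>The polarization of \<open>a p\<^sub>1\<^sup>3 + b p\<^sub>1 p\<^sub>2 + c p\<^sub>3\<close>.\<close>

definition sym_form :: "complex \<Rightarrow> complex \<Rightarrow> complex \<Rightarrow> complex^4 \<Rightarrow> complex^4 \<Rightarrow> complex^4 \<Rightarrow> complex" where
  "sym_form a b c x y z =
     a * (\<Sum>i\<in>UNIV. x $ i) * (\<Sum>i\<in>UNIV. y $ i) * (\<Sum>i\<in>UNIV. z $ i)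
     + b / 3 * ((\<Sum>i\<in>UNIV. x $ i) * (\<Sum>i\<in>UNIV. y $ i * z $ i)
        + (\<Sum>i\<in>UNIV. y $ i) * (\<Sum>i\<in>UNIV. x $ i * z $ i)
        + (\<Sum>i\<in>UNIV. z $ i) * (\<Sum>i\<in>UNIV. x $ i * y $ i))
     + c * (\<Sum>i\<in>UNIV. x $ i * y $ i * z $ i)"

lemma sym_form_diag: "sym_form a b c x x x = a * psum 1 x ^ 3 + b * psum 1 x * psum 2 x + c * psum 3 x"
  by (simp add: sym_form_def psum_def power2_eq_square power3_eq_cube)

lemma cubic_form_sym_form: "cubic_form (sym_form a b c)"
proof
  show "sym_form a b c x y z = sym_form a b c y x z" for x y z
    by (simp add: sym_form_def mult.commute mult.left_commute add.commute add.left_commute)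
  show "sym_form a b c x y z = sym_form a b c x z y" for x y z
    by (simp add: sym_form_def mult.commute mult.left_commute add.commute add.left_commute)
  show "sym_form a b c (x + x') y z = sym_form a b c x y z + sym_form a b c x' y z" for x x' y z
    by (simp add: sym_form_def sum.distrib distrib_left distrib_right)
  show "sym_form a b c (r *s x) y z = r * sym_form a b c x y z" for r x y z
  proof -
    have "(\<Sum>i\<in>UNIV. (r *s x) $ i) = r * (\<Sum>i\<in>UNIV. x $ i)"
      "(\<Sum>i\<in>UNIV. (r *s x) $ i * y $ i) = r * (\<Sum>i\<in>UNIV. x $ i * y $ i)" 
      "(\<Sum>i\<in>UNIV. (r *s x) $ i * y $ i * z $ i) = r * (\<Sum>i\<in>UNIV. x $ i * y $ i * z $ i)" for y
      by (simp_all add: sum_distrib_left mult.assoc)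
    note sums = this
    show ?thesis unfolding sym_form_def sums by (simp add: algebra_simps)
  qed
qed

lemma sym_form_basis:
  "sym_form a b c (axis i 1) (axis j 1) (axis k 1) =
     a + b / 3 * (of_bool (j = k) + of_bool (i = k) + of_bool (i = j)) + c * of_bool (i = j \<and> j = k)"
proof -
  have 1: "(\<Sum>l\<in>UNIV. axis m (1::complex) $ l) = 1" for m :: 4
    by (simp add: axis_def)
  have 2: "(\<Sum>l\<in>UNIV. axis m (1::complex) $ l * axis n 1 $ l) = of_bool (m = n)" for m n :: 4
    by (simp add: axis_def if_distrib[of "\<lambda>x. x * _"] cong: if_cong)
  have 3: "(\<Sum>l\<in>UNIV. axis i (1::complex) $ l * axis j 1 $ l * axis k 1 $ l) = of_bool (i = j \<and> j = k)"
    by (simp add: axis_def if_distrib[of "\<lambda>x. x * _"] cong: if_cong)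
  show ?thesis by (simp add: sym_form_def 1 2 3)
qed

lemma sym_form_perm:
  assumes "bij \<sigma>"
  shows "sym_form a b c (perm_vec \<sigma> x) (perm_vec \<sigma> y) (perm_vec \<sigma> z) = sym_form a b c x y z"
proof -
  have "(\<Sum>i\<in>UNIV. f (inv_into UNIV \<sigma> i)) = (\<Sum>i\<in>UNIV. f i)" for f :: "4 \<Rightarrow> complex"
    using sum.reindex_bij_betw[OF bij_imp_bij_inv[OF assms]] by blast
  from this[of "\<lambda>i. x $ i"] this[of "\<lambda>i. y $ i"] this[of "\<lambda>i. z $ i"] this[of "\<lambda>i. x $ i * y $ i"]
    this[of "\<lambda>i. x $ i * z $ i"] this[of "\<lambda>i. y $ i * z $ i"] this[of "\<lambda>i. x $ i * y $ i * z $ i"]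
  show ?thesis by (simp add: sym_form_def)
qed

text \<open>The values of \<open>T\<close> on triples of basis vectors depend only on which of the three indices coincide, so there are three
parameters; \<open>a\<close>, \<open>b\<close>, \<open>c\<close> solve the triangular system given by \<open>sym_form_basis\<close>.\<close>

lemma transposition_invariant_cubic_form:
  assumes "cubic_form T"
    and inv: "\<And>i j x y z. T (perm_vec (Transposition.transpose i j) x) (perm_vec (Transposition.transpose i j) y)
        (perm_vec (Transposition.transpose i j) z) = T x y z"
  shows "\<exists>a b c. T = sym_form a b c"
proof -
  interpret cubic_form T by fact
  define t where "t i j k = T (axis i 1) (axis j 1) (axis k 1)" for i j k
  have t: "t (Transposition.transpose m n i) (Transposition.transpose m n j) (Transposition.transpose m n k) = t i j k" for m n i j k
    using inv[of m n "axis i 1" "axis j 1" "axis k 1"] by (simp add: t_def perm_vec_axis)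
  have t1: "t i i i = t 1 1 1" for i
    using t[of i 1 i i i] by simp
  \<comment> \<open>Moving \<open>i\<close> to 1 and then the image of \<open>j\<close> to 2 keeps the earlier index in place.\<close>
  have t2: "t i i j = t 1 1 2" if "i \<noteq> j" for i j
  proof -
    let ?j = "Transposition.transpose i 1 j"
    have "?j \<noteq> 1" using that by (metis transpose_apply_first transpose_involutory)
    then show ?thesis using t[of i 1 i i j] t[of ?j 2 1 1 ?j] by simp
  qed
  have t3: "t i j k = t 1 2 3" if "i \<noteq> j" "i \<noteq> k" "j \<noteq> k" for i j k
  proof -
    define j' k' where "j' = Transposition.transpose i 1 j" and "k' = Transposition.transpose i 1 k"
    have 1: "j' \<noteq> 1" "k' \<noteq> 1" "j' \<noteq> k'"
      using that unfolding j'_def k'_def by (metis transpose_apply_first transpose_involutory)+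
    define k'' where "k'' = Transposition.transpose j' 2 k'"
    have "k'' \<noteq> 1" "k'' \<noteq> 2"
      using 1 unfolding k''_def by (auto simp: Transposition.transpose_def)
    with 1 show ?thesis
      using t[of i 1 i j k] t[of j' 2 1 j' k'] t[of k'' 3 1 2 k''] by (simp add: j'_def k'_def k''_def)
  qed
  have perm: "t i j k = t i k j" "t i j k = t k j i" for i j k
    unfolding t_def by (metis swap12 swap23)+
  define a b c where "a = t 1 2 3" and "b = 3 * (t 1 1 2 - t 1 2 3)"
    and "c = t 1 1 1 - 3 * t 1 1 2 + 2 * t 1 2 3"
  have "T (axis i 1) (axis j 1) (axis k 1) = sym_form a b c (axis i 1) (axis j 1) (axis k 1)" for i j k
  proof -
    consider "i = j" "j = k" | "i = j" "j \<noteq> k" | "i = k" "i \<noteq> j" | "j = k" "i \<noteq> j" | "i \<noteq> j" "i \<noteq> k" "j \<noteq> k"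
      by blast
    then show ?thesis unfolding sym_form_basis t_def[symmetric]
    proof cases
      case 1 then show "t i j k = a + b / 3 * (of_bool (j = k) + of_bool (i = k) + of_bool (i = j)) + c * of_bool (i = j \<and> j = k)"
        using t1[of k] by (simp add: a_def b_def c_def field_simps)
    next
      case 2 then show "t i j k = a + b / 3 * (of_bool (j = k) + of_bool (i = k) + of_bool (i = j)) + c * of_bool (i = j \<and> j = k)"
        using t2[of j k] by (simp add: a_def b_def field_simps)
    next
      case 3 then show "t i j k = a + b / 3 * (of_bool (j = k) + of_bool (i = k) + of_bool (i = j)) + c * of_bool (i = j \<and> j = k)"
        using t2[of k j] perm(1)[of k j k] by (simp add: a_def b_def field_simps)
    next
      case 4 then show "t i j k = a + b / 3 * (of_bool (j = k) + of_bool (i = k) + of_bool (i = j)) + c * of_bool (i = j \<and> j = k)"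
        using t2[of k i] perm(2)[of i k k] by (simp add: a_def b_def field_simps)
    next
      case 5 then show "t i j k = a + b / 3 * (of_bool (j = k) + of_bool (i = k) + of_bool (i = j)) + c * of_bool (i = j \<and> j = k)"
        using t3[of i j k] by (simp add: a_def)
    qed
  qed
  then show ?thesis
    using cubic_form_eq_on_basis[OF assms(1) cubic_form_sym_form] by blast
qed

text \<open>The scalars \<open>\<kappa> \<sigma>\<close> form a character of the symmetric group. Transpositions are
conjugate, so \<open>\<kappa>\<close> has the same value on all of them.\<close>

context smooth_cubic_form
begin

lemma invariant_if_zero_set_invariant:
  assumes zeros: "\<And>\<sigma> x. bij \<sigma> \<Longrightarrow> T x x x = 0 \<Longrightarrow> T (perm_vec \<sigma> x) (perm_vec \<sigma> x) (perm_vec \<sigma> x) = 0"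
  shows "T (perm_vec (Transposition.transpose i j) x) (perm_vec (Transposition.transpose i j) y)
        (perm_vec (Transposition.transpose i j) z) = T x y z"
proof -
  define A where "A \<sigma> x y z = T (perm_vec \<sigma> x) (perm_vec \<sigma> y) (perm_vec \<sigma> z)" for \<sigma> x y z
  have "\<exists>k. \<forall>x y z. A \<sigma> x y z = k * T x y z" if bij: "bij \<sigma>" for \<sigma>
  proof -
    have A: "cubic_form (A \<sigma>)" unfolding A_def by (rule cubic_form_perm) (rule cubic_form_axioms)
    obtain k where "\<And>x. A \<sigma> x x x = k * T x x x"
      using vanishing_cubic_proportional[OF A] zeros[OF bij] unfolding A_def by blast
    from cubic_form_diagonal_proportional[OF A cubic_form_axioms this] show ?thesis by blast
  qed
  then obtain \<kappa> where \<kappa>: "\<And>\<sigma> x y z. bij \<sigma> \<Longrightarrow> A \<sigma> x y z = \<kappa> \<sigma> * T x y z" by metis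
  obtain x0 w where w: "T x0 x0 w \<noteq> 0" using exists_zero smooth by blast
  have hom: "\<kappa> (\<sigma> \<circ> \<tau>) = \<kappa> \<sigma> * \<kappa> \<tau>" if "bij \<sigma>" "bij \<tau>" for \<sigma> \<tau>
  proof -
    have "A (\<sigma> \<circ> \<tau>) x0 x0 w = \<kappa> \<sigma> * (\<kappa> \<tau> * T x0 x0 w)"
      using \<kappa>[OF that(1)] \<kappa>[OF that(2)] by (simp add: A_def that flip: perm_vec_comp)
    then show ?thesis using \<kappa>[of "\<sigma> \<circ> \<tau>" x0 x0 w] w that by (simp add: bij_comp)
  qed
  have "\<kappa> id * T x0 x0 w = T x0 x0 w" using \<kappa>[of id x0 x0 w] by (simp add: A_def)
  then have one: "\<kappa> id = 1" using w by simp
  have square: "\<kappa> (Transposition.transpose m n) = 1 \<or> \<kappa> (Transposition.transpose m n) = - 1" for m n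
    using hom[of "Transposition.transpose m n" "Transposition.transpose m n"] one
    by (simp add: square_eq_1_iff)
  have conj: "\<kappa> (Transposition.transpose m n) = \<kappa> (Transposition.transpose 1 2)" if "m \<noteq> n" for m n
  proof -
    define g where "g = Transposition.transpose (Transposition.transpose 1 m 2) n \<circ> Transposition.transpose 1 m"
    have g: "bij g" "g 1 = m" "g 2 = n"
      using that by (auto simp: g_def bij_comp Transposition.transpose_def)
    have "Transposition.transpose m n \<circ> g = g \<circ> Transposition.transpose 1 2"
      using g by (auto simp: Transposition.transpose_def fun_eq_iff bij_def inj_eq)
    then have "\<kappa> (Transposition.transpose m n) * \<kappa> g = \<kappa> g * \<kappa> (Transposition.transpose 1 2)"
      using g by (metis hom bij_swap_iff bij_transpose)
    moreover have "\<kappa> (inv_into UNIV g) * \<kappa> g = 1"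
      using hom[of "inv_into UNIV g" g] g one by (simp add: bij_imp_bij_inv bij_is_inj)
    ultimately show ?thesis by auto
  qed
  have "\<kappa> (Transposition.transpose 1 2) = 1"
  proof (rule ccontr)
    assume "\<kappa> (Transposition.transpose 1 2) \<noteq> 1"
    then have neg: "\<kappa> (Transposition.transpose m n) = - 1" if "m \<noteq> n" for m n
      using square conj that by metis
    define u :: "complex^4" where "u = 1"
    have u: "perm_vec \<sigma> u = u" for \<sigma> by (simp add: vec_eq_iff u_def)
    \<comment> \<open>A transposition that avoids \<open>i\<close> fixes both \<open>u\<close> and the basis vector, and changes the sign of the derivative.\<close>
    have "T u u (axis i 1) = 0" for i
    proof -
      obtain m n where mn: "m \<noteq> n" "m \<noteq> i" "n \<noteq> i"
        by (rule that[of "i + 1" "i + 2"]) simp_all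
      have "A (Transposition.transpose m n) u u (axis i 1) = - T u u (axis i 1)"
        using \<kappa> neg[OF mn(1)] by simp
      then show ?thesis using mn by (simp add: A_def u perm_vec_axis Transposition.transpose_def)
    qed
    then have "T u u y = 0" for y by (subst T_expand) simp
    moreover have "u \<noteq> 0" by (simp add: u_def)
    ultimately show False using smooth by blast
  qed
  then have "\<kappa> (Transposition.transpose i j) = 1"
    using conj[of i j] one by (cases "i = j") auto
  then show ?thesis using \<kappa>[of "Transposition.transpose i j" x y z] by (simp add: A_def)
qed

end

text \<open>The zero locus consists of one-dimensional subspaces, so the vector \<open>x\<close> has to be replaced by its span.\<close>

lemma symmetric_zero_locus_imp:
  assumes "homogeneous 3 F" "symmetric_surface (zero_locus F)" "bij \<sigma>" "eval_poly F x = 0"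
  shows "eval_poly F (perm_vec \<sigma> x) = 0"
proof -
  obtain T where T: "cubic_form T" "\<And>x. eval_poly F x = T x x x"
    using cubic_polarization[OF assms(1)] by blast
  interpret cubic_form T by fact
  show ?thesis
  proof (cases "x = 0")
    case True
    then show ?thesis by (simp add: T perm_vec_zero)
  next
    case False
    let ?P = "vec.span {x}"
    have "vec.dim ?P = 1" using False by (simp add: vec.dim_eq_card_independent)
    then have "?P \<in> zero_locus F"
      using assms(4) vec.subspace_span[of "{x}"]
      by (auto simp: zero_locus_def CP3_def T scale1 scale2 scale3 vec.span_singleton simp del: vec.subspace_span)
    then have "perm_point \<sigma> ?P \<in> zero_locus F"
      using assms(2,3) by (auto simp: symmetric_surface_def BijGroup_def Bij_def)
    moreover have "perm_vec \<sigma> x \<in> perm_point \<sigma> ?P"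
      by (simp add: perm_point_def vec.span_base)
    ultimately show ?thesis by (simp add: zero_locus_def)
  qed
qed

theorem symmetric_cubic_normal_form:
  assumes "homogeneous 3 F" "smooth_surface F" "symmetric_surface (zero_locus F)"
  shows "\<exists>a b c. smooth_cubic_form (sym_form a b c) \<and> (\<forall>x. eval_poly F x = sym_form a b c x x x)"
proof -
  obtain T where T: "cubic_form T" "\<And>x. eval_poly F x = T x x x"
    "\<And>l x. eval_poly (partial_deriv l F) x = 3 * T x x (axis l 1)"
    using cubic_polarization[OF assms(1)] by blast
  have "smooth_cubic_form T"
  proof (rule smooth_cubic_form.intro[OF T(1)], unfold_locales)
    show "\<exists>y. T x x y \<noteq> 0" if "x \<noteq> 0" "T x x x = 0" for x
      using assms(2) that T(2,3) unfolding smooth_surface_def by (metis mult_zero_right)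
  qed
  then interpret smooth_cubic_form T .
  have "\<exists>a b c. T = sym_form a b c"
  proof (rule transposition_invariant_cubic_form[OF T(1)], rule invariant_if_zero_set_invariant)
    show "T (perm_vec \<sigma> x) (perm_vec \<sigma> x) (perm_vec \<sigma> x) = 0" if "bij \<sigma>" "T x x x = 0" for \<sigma> x
      using symmetric_zero_locus_imp[OF assms(1,3) that(1), of x] that(2) by (simp add: T(2))
  qed
  then show ?thesis using T(2) smooth_cubic_form_axioms by auto
qed

section \<open>Orbits as coset spaces\<close>

text \<open>The action as a homomorphism to permutations, in terms of points. Transport along
bijections and passage to subgroups and invariant subsets become immediate in this form.\<close>

lemma is_gset_iff:
  "is_gset G X \<longleftrightarrow> group G \<and>
     (\<forall>g\<in>carrier G. snd X g \<in> extensional (fst X)) \<and>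
     (\<forall>g\<in>carrier G. \<forall>x\<in>fst X. snd X g x \<in> fst X) \<and>
     (\<forall>x\<in>fst X. snd X \<one>\<^bsub>G\<^esub> x = x) \<and>
     (\<forall>g\<in>carrier G. \<forall>h\<in>carrier G. \<forall>x\<in>fst X. snd X (g \<otimes>\<^bsub>G\<^esub> h) x = snd X g (snd X h x))"
    (is "_ \<longleftrightarrow> ?R")
proof
  assume "is_gset G X"
  then interpret group_action G "fst X" "snd X" by (simp add: is_gset_def)
  interpret group_hom G "BijGroup (fst X)" "snd X" by (rule group_hom)
  show ?R
  proof (intro conjI ballI)
    show "group G" by (rule G.group_axioms)
    show "snd X g \<in> extensional (fst X)" if "g \<in> carrier G" for g
      using bij_prop0[OF that] by (rule Bij_imp_extensional)
    show "snd X g x \<in> fst X" if "g \<in> carrier G" "x \<in> fst X" for g x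
      using element_image that by blast
    show "snd X \<one>\<^bsub>G\<^esub> x = x" if "x \<in> fst X" for x
      using that by (metis id_eq_one restrict_apply')
    show "snd X (g \<otimes>\<^bsub>G\<^esub> h) x = snd X g (snd X h x)"
      if "g \<in> carrier G" "h \<in> carrier G" "x \<in> fst X" for g h x
      using composition_rule that by blast
  qed
next
  assume R: ?R
  then interpret group G by blast
  have "bij_betw (snd X g) (fst X) (fst X)" if g: "g \<in> carrier G" for g
  proof (rule bij_betw_byWitness[where f' = "snd X (inv\<^bsub>G\<^esub> g)"])
    have "snd X (inv\<^bsub>G\<^esub> g) (snd X g x) = x \<and> snd X g (snd X (inv\<^bsub>G\<^esub> g) x) = x" if "x \<in> fst X" for x
      using R g that by (metis inv_closed l_inv r_inv)
    then show "\<forall>a\<in>fst X. snd X (inv\<^bsub>G\<^esub> g) (snd X g a) = a" "\<forall>a\<in>fst X. snd X g (snd X (inv\<^bsub>G\<^esub> g) a) = a"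
      by blast+
    show "snd X g ` fst X \<subseteq> fst X" "snd X (inv\<^bsub>G\<^esub> g) ` fst X \<subseteq> fst X"
      using R g by auto
  qed
  then have Bij: "snd X g \<in> Bij (fst X)" if "g \<in> carrier G" for g
    using R that by (auto simp: Bij_def)
  have "snd X (g \<otimes>\<^bsub>G\<^esub> h) = compose (fst X) (snd X g) (snd X h)"
    if "g \<in> carrier G" "h \<in> carrier G" for g h
    by (rule extensionalityI[of _ "fst X"]) (use R that in \<open>auto simp: compose_eq\<close>)
  then have "snd X \<in> hom G (BijGroup (fst X))"
    using Bij by (auto simp: hom_def BijGroup_def)
  then show "is_gset G X"
    unfolding is_gset_def
    by (intro group_action.intro group_hom.intro group_hom_axioms.intro group_BijGroup group_axioms)
qed

lemma gset_iso_transport: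
  assumes X: "is_gset G X" and f: "bij_betw f (fst X) (fst Y)"
    and ext: "\<And>g. g \<in> carrier G \<Longrightarrow> snd Y g \<in> extensional (fst Y)"
    and equi: "\<And>g x. g \<in> carrier G \<Longrightarrow> x \<in> fst X \<Longrightarrow> f (snd X g x) = snd Y g (f x)"
  shows "gset_iso G X Y"
proof -
  have Y: "fst Y = f ` fst X" using f by (simp add: bij_betw_def)
  interpret group G using X by (simp add: is_gset_iff)
  have "is_gset G Y"
    using X unfolding is_gset_iff Y by (auto simp: ext[unfolded Y] simp flip: equi)
  then show ?thesis
    using X f equi by (auto simp: gset_iso_def)
qed

text \<open>The restriction makes each permutation extensional, as group actions require.\<close>

definition subgset :: "('g \<Rightarrow> 'b \<Rightarrow> 'b) \<Rightarrow> 'b set \<Rightarrow> ('g, 'b) gset" where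
  "subgset \<phi> A = (A, \<lambda>g. restrict (\<phi> g) A)"

lemma gset_iso_disjoint_union:
  assumes "A \<inter> B = {}" "gset_iso G (subgset \<phi> A) X" "gset_iso G (subgset \<phi> B) Y"
  shows "gset_iso G (subgset \<phi> (A \<union> B)) (gset_sum X Y)"
proof -
  obtain f h where f: "bij_betw f A (fst X)" "\<And>g x. g \<in> carrier G \<Longrightarrow> x \<in> A \<Longrightarrow> f (\<phi> g x) = snd X g (f x)"
    and h: "bij_betw h B (fst Y)" "\<And>g x. g \<in> carrier G \<Longrightarrow> x \<in> B \<Longrightarrow> h (\<phi> g x) = snd Y g (h x)"
    and A: "is_gset G (subgset \<phi> A)" and B: "is_gset G (subgset \<phi> B)"
    using assms(2,3) by (auto simp: gset_iso_def subgset_def)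
  define k where "k x = (if x \<in> A then Inl (f x) else Inr (h x))" for x
  have A': "\<phi> g x \<in> A" if "g \<in> carrier G" "x \<in> A" for g x
    using A that by (auto simp: is_gset_iff subgset_def)
  have B': "\<phi> g x \<in> B" if "g \<in> carrier G" "x \<in> B" for g x
    using B that by (auto simp: is_gset_iff subgset_def)
  show ?thesis
  proof (rule gset_iso_transport[where f = k])
    show "is_gset G (subgset \<phi> (A \<union> B))"
      using A B A' B' unfolding is_gset_iff by (auto simp: subgset_def)
    have "bij_betw k A (Inl ` fst X)"
      using f(1) by (auto simp: k_def bij_betw_def inj_on_def)
    moreover have "bij_betw k B (Inr ` fst Y)"
    proof -
      have "k x = Inr (h x)" if "x \<in> B" for x using assms(1) that by (auto simp: k_def)
      then show ?thesis using h(1) by (auto simp: bij_betw_def inj_on_def)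
    qed
    ultimately have "bij_betw k (A \<union> B) (Inl ` fst X \<union> Inr ` fst Y)"
      by (rule bij_betw_combine) auto
    then show "bij_betw k (fst (subgset \<phi> (A \<union> B))) (fst (gset_sum X Y))"
      by (simp add: subgset_def gset_sum_def Plus_def)
    show "snd (gset_sum X Y) g \<in> extensional (fst (gset_sum X Y))" for g
      by (simp add: gset_sum_def)
    show "k (snd (subgset \<phi> (A \<union> B)) g x) = snd (gset_sum X Y) g (k x)"
      if "g \<in> carrier G" "x \<in> fst (subgset \<phi> (A \<union> B))" for g x
    proof (cases "x \<in> A")
      case True
      then have "f x \<in> fst X" using f(1) by (auto simp: bij_betw_def)
      with True that show ?thesis
        by (simp add: subgset_def gset_sum_def k_def A' f(2) InlI)
    next
      case False
      then have "x \<in> B" using that by (simp add: subgset_def)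
      moreover then have "h x \<in> fst Y" using h(1) by (auto simp: bij_betw_def)
      moreover have "\<phi> g x \<notin> A" using assms(1) B' that(1) \<open>x \<in> B\<close> by blast
      ultimately show ?thesis using False that
        by (simp add: subgset_def gset_sum_def k_def h(2) InrI)
    qed
  qed
qed

context group_action
begin

interpretation group G using group_hom by (rule group_hom.axioms(1))

lemma act_closed: "g \<in> carrier G \<Longrightarrow> x \<in> E \<Longrightarrow> \<phi> g x \<in> E"
  using element_image by blast

lemma act_one: "x \<in> E \<Longrightarrow> \<phi> \<one> x = x"
  by (metis id_eq_one restrict_apply')

lemma act_eq_iff:
  assumes "g \<in> carrier G" "x \<in> E" "y \<in> E"
  shows "\<phi> g x = y \<longleftrightarrow> x = \<phi> (inv g) y"
  using assms by (metis act_one composition_rule inv_closed l_inv r_inv)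

lemma orbit_subset: "x \<in> E \<Longrightarrow> orbit G \<phi> x \<subseteq> E"
  by (auto simp: orbit_def act_closed)

lemma orbit_closed: "x \<in> E \<Longrightarrow> y \<in> orbit G \<phi> x \<Longrightarrow> g \<in> carrier G \<Longrightarrow> \<phi> g y \<in> orbit G \<phi> x"
  by (auto simp: orbit_def simp flip: composition_rule)

lemma is_gset_orbit:
  assumes "x \<in> E" shows "is_gset G (subgset \<phi> (orbit G \<phi> x))"
  unfolding is_gset_iff subgset_def fst_conv snd_conv
  using group_axioms assms orbit_subset[OF assms] orbit_closed[OF assms] act_one composition_rule
  by (auto simp: subset_iff)

text \<open>The isomorphism sends \<open>y\<close> to the set of group elements that move \<open>x\<close> to \<open>y\<close>, which is a left coset of the
stabilizer.\<close>

lemma orbit_iso_cosets: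
  assumes x: "x \<in> E"
  shows "gset_iso G (subgset \<phi> (orbit G \<phi> x)) (coset_gset G (stabilizer G \<phi> x))"
proof -
  let ?S = "stabilizer G \<phi> x"
  define f where "f y = {g \<in> carrier G. \<phi> g x = y}" for y
  have sub: "?S \<subseteq> carrier G" by (auto simp: stabilizer_def)
  have f: "f (\<phi> h x) = h <# ?S" if h: "h \<in> carrier G" for h
  proof (intro Set.set_eqI iffI)
    fix g assume "g \<in> f (\<phi> h x)"
    then have g: "g \<in> carrier G" "\<phi> g x = \<phi> h x" by (auto simp: f_def)
    then have "\<phi> (inv h \<otimes> g) x = x"
      using h x act_eq_iff[of h x "\<phi> h x"] act_closed by (simp add: composition_rule)
    then have "inv h \<otimes> g \<in> ?S" using g h by (simp add: stabilizer_def)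
    moreover have "g = h \<otimes> (inv h \<otimes> g)" using g h by (simp flip: m_assoc)
    ultimately show "g \<in> h <# ?S" by (auto simp: l_coset_def)
  next
    fix g assume "g \<in> h <# ?S"
    then show "g \<in> f (\<phi> h x)"
      using h x by (auto simp: l_coset_def f_def stabilizer_def composition_rule)
  qed
  show ?thesis
  proof (rule gset_iso_transport[where f = f])
    show "is_gset G (subgset \<phi> (orbit G \<phi> x))" by (rule is_gset_orbit[OF x])
    have "inj_on f (orbit G \<phi> x)"
      by (auto simp: inj_on_def orbit_def f_def)
    moreover have "f ` orbit G \<phi> x = lcosets ?S"
      by (auto simp: orbit_def LCOSETS_def f image_iff) (metis f)
    ultimately show "bij_betw f (fst (subgset \<phi> (orbit G \<phi> x))) (fst (coset_gset G ?S))"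
      by (simp add: bij_betw_def subgset_def coset_gset_def)
    show "snd (coset_gset G ?S) g \<in> extensional (fst (coset_gset G ?S))" for g
      by (simp add: coset_gset_def)
    show "f (snd (subgset \<phi> (orbit G \<phi> x)) g y) = snd (coset_gset G ?S) g (f y)"
      if g: "g \<in> carrier G" and y: "y \<in> fst (subgset \<phi> (orbit G \<phi> x))" for g y
    proof -
      from y obtain h where h: "h \<in> carrier G" "y = \<phi> h x" by (auto simp: subgset_def orbit_def)
      have "h <# ?S \<in> lcosets ?S" using h by (auto simp: LCOSETS_def)
      moreover have "f (\<phi> g y) = g <# (h <# ?S)"
        using g h x sub by (simp add: lcos_m_assoc f flip: composition_rule)
      ultimately show ?thesis using y h by (simp add: subgset_def coset_gset_def f)
    qed
  qed
qed

lemma stabilizer_conjugate: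
  assumes "x \<in> E" "y \<in> orbit G \<phi> x"
  shows "conjugate_in G (stabilizer G \<phi> x) (stabilizer G \<phi> y)"
proof -
  obtain g where g: "g \<in> carrier G" "y = \<phi> g x" using assms(2) by (auto simp: orbit_def)
  have y: "y \<in> E" using g assms act_closed by simp
  have "stabilizer G \<phi> y = g <# stabilizer G \<phi> x #> inv g"
  proof (intro Set.set_eqI iffI)
    fix k assume "k \<in> stabilizer G \<phi> y"
    then have k: "k \<in> carrier G" "\<phi> k y = y" by (auto simp: stabilizer_def)
    have "\<phi> (inv g) y = x" using act_eq_iff[of g x y] g assms y by simp
    then have "inv g \<otimes> k \<otimes> g \<in> stabilizer G \<phi> x"
      using k g assms y by (simp add: stabilizer_def composition_rule)
    moreover have "k = g \<otimes> (inv g \<otimes> k \<otimes> g) \<otimes> inv g"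
      using k g by (metis inv_closed m_assoc m_closed r_inv r_one l_one)
    ultimately show "k \<in> g <# stabilizer G \<phi> x #> inv g"
      by (auto simp: l_coset_def r_coset_def)
  next
    fix k assume "k \<in> g <# stabilizer G \<phi> x #> inv g"
    then obtain s where s: "s \<in> stabilizer G \<phi> x" "k = g \<otimes> s \<otimes> inv g"
      by (auto simp: l_coset_def r_coset_def)
    have "\<phi> (inv g) y = x" using act_eq_iff[of g x y] g assms y by simp
    then show "k \<in> stabilizer G \<phi> y"
      using s g assms y by (auto simp: stabilizer_def composition_rule)
  qed
  then show ?thesis using g by (auto simp: conjugate_in_def)
qed

lemma orbit_eq: "x \<in> E \<Longrightarrow> y \<in> orbit G \<phi> x \<Longrightarrow> orbit G \<phi> y = orbit G \<phi> x"
  using disjoint_union[of "orbit G \<phi> y" "orbit G \<phi> x"] orbit_refl[of y] orbit_subset[of x]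
  by (auto simp: orbits_def)

text \<open>The length of every orbit is a power of \<open>p\<close>. If none of them were 1, then \<open>p\<close> would divide
their sum.\<close>

theorem p_group_fixed_point:
  assumes "prime p" "order G = p ^ n" "finite E" "\<not> p dvd card E"
  shows "\<exists>x\<in>E. stabilizer G \<phi> x = carrier G"
proof -
  have "partition E (orbits G E \<phi>)" by (rule orbit_partition)
  then have "card E = (\<Sum>b\<in>orbits G E \<phi>. card b)"
    using partition.disjoint_sum[OF _ assms(3), of "orbits G E \<phi>" "\<lambda>_. 1::nat"] by simp
  with assms(4) obtain x where x: "x \<in> E" "\<not> p dvd card (orbit G \<phi> x)"
    by (auto simp: orbits_def intro!: dvd_sum)
  have "card (orbit G \<phi> x) dvd p ^ n"
    using orbit_stabilizer_theorem[OF x(1)] assms(2) by (metis dvd_triv_left)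
  then obtain i where i: "card (orbit G \<phi> x) = p ^ i"
    using assms(1) by (auto simp: divides_primepow_nat)
  with x(2) have "i = 0" by (cases i) auto
  with i have "card (orbit G \<phi> x) = 1" by simp
  then have "orbit G \<phi> x = {x}"
    using orbit_refl[OF x(1)] by (auto simp: card_1_singleton_iff)
  then have "stabilizer G \<phi> x = carrier G"
    by (auto simp: stabilizer_def orbit_def)
  with x(1) show ?thesis by blast
qed

end

section \<open>Permuting the lines of projective space\<close>

lemma linear_perm_vec: "Vector_Spaces.linear ((*s)) ((*s)) (perm_vec \<sigma>)"
  by unfold_locales (simp_all add: perm_vec_add perm_vec_scale)

lemma inj_perm_vec: "bij \<sigma> \<Longrightarrow> inj (perm_vec \<sigma>)"
  by (metis injI perm_vec_inv(2))

lemma perm_vec_image_comp: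
  "bij \<sigma> \<Longrightarrow> bij \<tau> \<Longrightarrow> perm_vec \<sigma> ` perm_vec \<tau> ` A = perm_vec (\<sigma> \<circ> \<tau>) ` A"
  by (simp add: image_image perm_vec_comp)

lemma perm_vec_image_inv:
  assumes "bij \<sigma>"
  shows "perm_vec \<sigma> ` perm_vec (inv_into UNIV \<sigma>) ` A = A" "perm_vec (inv_into UNIV \<sigma>) ` perm_vec \<sigma> ` A = A"
  using assms by (simp_all add: image_image)

lemma subspace_perm_image: "vec.subspace W \<Longrightarrow> vec.subspace (perm_vec \<sigma> ` W)"
  by (rule vec.linear_subspace_image[OF linear_perm_vec])

lemma dim_perm_image: "bij \<sigma> \<Longrightarrow> vec.dim (perm_vec \<sigma> ` W) = vec.dim W"
  by (rule vec.dim_image_eq[OF linear_perm_vec]) (metis inj_perm_vec inj_on_subset subset_UNIV)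

lemma span_perm_image: "perm_vec \<sigma> ` vec.span {u, v} = vec.span {perm_vec \<sigma> u, perm_vec \<sigma> v}"
  using vec.linear_span_image[OF linear_perm_vec, of \<sigma> "{u, v}"] by simp

lemma span_pair_iff: "x \<in> vec.span {u, v} \<longleftrightarrow> (\<exists>\<alpha> \<beta>. x = \<alpha> *s u + \<beta> *s v)" for x :: "complex^'n::finite"
proof -
  have "x \<in> vec.span {u, v} \<longleftrightarrow> (\<exists>\<alpha> \<beta>. x - \<alpha> *s u = \<beta> *s v)"
    by (auto simp: vec.span_insert[of u] vec.span_singleton)
  then show ?thesis by (simp add: diff_eq_eq add.commute)
qed

lemma dim_span_pair:
  fixes u v :: "complex^'n::finite"
  assumes "u \<noteq> 0" "\<And>k. v \<noteq> k *s u"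
  shows "vec.dim (vec.span {u, v}) = 2"
proof -
  have "vec.independent {u}" using assms(1) by simp
  moreover have "v \<notin> vec.span {u}" using assms(2) by (auto simp: vec.span_singleton)
  ultimately have "vec.independent {v, u}" by (rule vec.independent_insertI[rotated])
  moreover have "u \<noteq> v" using assms(2)[of 1] by auto
  ultimately show ?thesis by (simp add: insert_commute[of u] vec.dim_eq_card_independent)
qed

lemma plane_eq_span:
  fixes W :: "(complex^'n::finite) set"
  assumes "vec.subspace W" "vec.dim W = 2" "v \<in> W" "v \<noteq> 0"
  obtains w where "W = vec.span {v, w}" "w \<in> W"
proof -
  obtain B where B: "{v} \<subseteq> B" "B \<subseteq> W" "vec.independent B" "W \<subseteq> vec.span B"
    using vec.maximal_independent_subset_extend[of "{v}" W] assms(3,4) by auto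
  then have "card B = 2" using assms(2) vec.dim_unique[OF B(2,4,3) refl] by simp
  then obtain w where w: "B = {v, w}" using B(1) by (auto simp: card_2_iff)
  have "W = vec.span B" using B assms(1) by (simp add: vec.span_minimal subset_antisym)
  then show thesis using that w B(2) by auto
qed

lemma plane_eqI:
  fixes W :: "(complex^'n::finite) set"
  assumes "vec.subspace W" "vec.dim W = 2" "vec.subspace V" "vec.dim V = 2" "W \<subseteq> V"
  shows "W = V"
  by (rule vec.subspace_dim_equal) (use assms in simp_all)

text \<open>In the projective picture: every line meets every hyperplane, here the zero set of the linear functional
\<open>f\<close>.\<close>

lemma plane_meets_hyperplane:
  fixes W :: "(complex^'n::finite) set" and f :: "complex^'n \<Rightarrow> complex"
  assumes W: "vec.subspace W" "vec.dim W = 2"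
    and f: "\<And>x y. f (x + y) = f x + f y" "\<And>k x. f (k *s x) = k * f x"
  shows "\<exists>v\<in>W. v \<noteq> 0 \<and> f v = 0"
proof -
  have "\<not> W \<subseteq> {0}" using vec.dim_subset[of W "{0}"] W(2) by auto
  then obtain u where u: "u \<in> W" "u \<noteq> 0" by auto
  obtain w where w: "W = vec.span {u, w}" "w \<in> W" using plane_eq_span[OF W u] by blast
  show ?thesis
  proof (cases "f u = 0")
    case True then show ?thesis using u by blast
  next
    case False
    let ?v = "f u *s w + (- f w) *s u"
    have "?v \<in> W" using u(1) w(2) W(1) by (intro vec.subspace_add vec.subspace_scale)
    moreover have "f ?v = 0" by (simp only: f(1) f(2)) simp
    moreover have "?v \<noteq> 0"
    proof
      assume "?v = 0"
      then have "f u *s w = f w *s u" by (simp add: vec_eq_iff add_eq_0_iff)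
      then have "w = (f w / f u) *s u" using False by (simp add: vec_eq_iff field_simps)
      then have "w \<in> vec.span {u}" by (metis rangeI vec.span_singleton)
      then have "W \<subseteq> vec.span {u}"
        unfolding w(1) by (intro vec.span_minimal vec.subspace_span) (simp add: vec.span_base)
      then have "vec.dim W \<le> card {u}" by (rule vec.dim_le_card) simp
      then show False using W(2) by simp
    qed
    ultimately show ?thesis by blast
  qed
qed

text \<open>Computations with lines take place in the two-dimensional subspaces \<open>W\<close> under them, which are the
planes in the names of definitions and lemmas.\<close>

definition pline :: "(complex^4) set \<Rightarrow> point set" where
  "pline W = {P \<in> CP3. P \<subseteq> W}"

lemma span_CP3: "x \<noteq> 0 \<Longrightarrow> vec.span {x} \<in> CP3"
  by (simp add: CP3_def vec.subspace_span vec.dim_eq_card_independent)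

lemma span_singleton_subset: "vec.subspace W \<Longrightarrow> vec.span {x} \<subseteq> W \<longleftrightarrow> x \<in> W" for x :: "complex^'n::finite"
  by (meson empty_subsetI insert_subset vec.span_base vec.span_minimal singletonI subsetD)

lemma pline_subset_iff:
  assumes "vec.subspace W" "vec.subspace V"
  shows "pline W \<subseteq> pline V \<longleftrightarrow> W \<subseteq> V"
proof
  assume sub: "pline W \<subseteq> pline V"
  show "W \<subseteq> V"
  proof
    fix x assume x: "x \<in> W"
    show "x \<in> V"
    proof (cases "x = 0")
      case True then show ?thesis using assms(2) by (simp add: vec.subspace_0)
    next
      case False
      then have "vec.span {x} \<in> pline W" using x assms by (simp add: pline_def span_CP3 span_singleton_subset)
      then have "vec.span {x} \<in> pline V" using sub by blast
      then show ?thesis using assms by (simp add: pline_def span_singleton_subset)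
    qed
  qed
qed (auto simp: pline_def)

lemma pline_eq_iff:
  assumes "vec.subspace W" "vec.subspace V"
  shows "pline W = pline V \<longleftrightarrow> W = V"
  using pline_subset_iff[OF assms] pline_subset_iff[OF assms(2,1)] by blast

lemma perm_point_CP3:
  assumes "bij \<sigma>" "P \<in> CP3" shows "perm_point \<sigma> P \<in> CP3"
  using assms by (simp add: CP3_def perm_point_def subspace_perm_image dim_perm_image)

lemma perm_point_pline:
  assumes "bij \<sigma>"
  shows "perm_point \<sigma> ` pline W = pline (perm_vec \<sigma> ` W)"
proof (intro Set.set_eqI iffI)
  fix P assume "P \<in> perm_point \<sigma> ` pline W"
  then show "P \<in> pline (perm_vec \<sigma> ` W)"
    using perm_point_CP3[OF assms] by (auto simp: pline_def perm_point_def)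
next
  fix P assume P: "P \<in> pline (perm_vec \<sigma> ` W)"
  let ?Q = "perm_point (inv_into UNIV \<sigma>) P"
  have "?Q \<in> CP3" using P assms by (auto simp: pline_def intro: perm_point_CP3 bij_imp_bij_inv)
  moreover have "?Q \<subseteq> W"
    using P image_mono[of P "perm_vec \<sigma> ` W" "perm_vec (inv_into UNIV \<sigma>)"]
    by (simp add: pline_def perm_point_def perm_vec_image_inv[OF assms])
  moreover have "P = perm_point \<sigma> ?Q"
    by (simp add: perm_point_def perm_vec_image_inv[OF assms])
  ultimately show "P \<in> perm_point \<sigma> ` pline W" by (auto simp: pline_def)
qed

lemma pline_subset_zero_locus:
  assumes "vec.subspace W" "eval_poly F 0 = 0"
  shows "pline W \<subseteq> zero_locus F \<longleftrightarrow> (\<forall>x\<in>W. eval_poly F x = 0)"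
proof
  assume L: "pline W \<subseteq> zero_locus F"
  show "\<forall>x\<in>W. eval_poly F x = 0"
  proof
    fix x assume x: "x \<in> W"
    show "eval_poly F x = 0"
    proof (cases "x = 0")
      case False
      then have "vec.span {x} \<in> pline W" using x assms by (simp add: pline_def span_CP3 span_singleton_subset)
      then show ?thesis using L vec.span_base[of x "{x}"] by (auto simp: zero_locus_def)
    qed (simp add: assms)
  qed
qed (auto simp: pline_def zero_locus_def)

lemma lines_on_zero_locus:
  assumes "eval_poly F 0 = 0"
  shows "lines_on (zero_locus F) =
    pline ` {W. vec.subspace W \<and> vec.dim W = 2 \<and> (\<forall>x\<in>W. eval_poly F x = 0)}"
  using pline_subset_zero_locus[OF _ assms]
  by (auto simp: lines_on_def is_line_def pline_def[symmetric])

lemma carrier_S4: "\<sigma> \<in> carrier S4 \<longleftrightarrow> bij \<sigma>"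
  by (simp add: BijGroup_def Bij_def)

lemma mult_S4: "bij \<sigma> \<Longrightarrow> bij \<tau> \<Longrightarrow> \<sigma> \<otimes>\<^bsub>S4\<^esub> \<tau> = \<sigma> \<circ> \<tau>"
  by (simp add: BijGroup_def Bij_def compose_def restrict_def comp_def)

lemma one_S4: "\<one>\<^bsub>S4\<^esub> = id"
  by (simp add: BijGroup_def restrict_def id_def)

lemma order_S4: "order S4 = 24"
proof -
  have "carrier S4 = {p. p permutes (UNIV :: 4 set)}"
    by (auto simp: carrier_S4 permutes_bij intro: bij_imp_permutes)
  then show ?thesis by (simp add: order_def card_permutations[of UNIV 4] fact_numeral)
qed

lemma is_gset_lines:
  assumes "symmetric_surface X"
  shows "is_gset S4 (lines_gset X)"
proof -
  have closed: "perm_point \<sigma> ` l \<in> lines_on X" if "l \<in> lines_on X" "bij \<sigma>" for \<sigma> l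
  proof -
    have "is_line l" and l: "l \<subseteq> X" using that(1) by (simp_all add: lines_on_def)
    then obtain W where W: "vec.subspace W" "vec.dim W = 2" "l = pline W"
      by (auto simp: is_line_def pline_def)
    have "perm_point \<sigma> ` l = pline (perm_vec \<sigma> ` W)"
      by (simp add: W(3) perm_point_pline that)
    moreover have "vec.subspace (perm_vec \<sigma> ` W)" "vec.dim (perm_vec \<sigma> ` W) = 2"
      by (simp_all add: subspace_perm_image dim_perm_image W that)
    ultimately have "is_line (perm_point \<sigma> ` l)" by (auto simp: is_line_def pline_def)
    moreover have "perm_point \<sigma> ` X = X"
      using assms that(2) by (simp add: symmetric_surface_def carrier_S4)
    then have "perm_point \<sigma> ` l \<subseteq> X" using l by blast
    ultimately show ?thesis by (simp add: lines_on_def)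
  qed
  have comp: "perm_point (\<sigma> \<circ> \<tau>) = perm_point \<sigma> \<circ> perm_point \<tau>" if "bij \<sigma>" "bij \<tau>" for \<sigma> \<tau>
    by (rule ext) (simp add: perm_point_def image_image perm_vec_comp that)
  have "perm_point id = id"
    by (rule ext) (simp add: perm_point_def)
  with closed show ?thesis
    unfolding is_gset_iff lines_gset_def fst_conv snd_conv line_action_def
    by (intro conjI ballI) (simp_all add: group_BijGroup carrier_S4 mult_S4 one_S4 comp image_comp bij_comp)
qed

section \<open>Smooth symmetric cubics\<close>

definition vec4 :: "complex \<Rightarrow> complex \<Rightarrow> complex \<Rightarrow> complex \<Rightarrow> complex^4" where
  "vec4 p q r s = (\<chi> i. if i = 1 then p else if i = 2 then q else if i = 3 then r else s)"

lemma vec4_nth [simp]: "vec4 p q r s $ 1 = p" "vec4 p q r s $ 2 = q" "vec4 p q r s $ 3 = r" "vec4 p q r s $ 4 = s"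
  by (simp_all add: vec4_def)

lemma vec4_eqI: "x $ 1 = p \<Longrightarrow> x $ 2 = q \<Longrightarrow> x $ 3 = r \<Longrightarrow> x $ 4 = s \<Longrightarrow> x = vec4 p q r s"
  by (simp add: vec_eq_iff forall_4)

lemma vec4_add [simp]: "vec4 p q r s + vec4 p' q' r' s' = vec4 (p + p') (q + q') (r + r') (s + s')"
  by (simp add: vec_eq_iff forall_4)

lemma vec4_scale [simp]: "k *s vec4 p q r s = vec4 (k * p) (k * q) (k * r) (k * s)"
  by (simp add: vec_eq_iff forall_4)

lemma vec4_eq_iff [simp]: "vec4 p q r s = vec4 p' q' r' s' \<longleftrightarrow> p = p' \<and> q = q' \<and> r = r' \<and> s = s'"
  by (simp add: vec_eq_iff forall_4)

lemma vec4_eq_0_iff [simp]: "vec4 p q r s = 0 \<longleftrightarrow> p = 0 \<and> q = 0 \<and> r = 0 \<and> s = 0"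
  by (simp add: vec_eq_iff forall_4)

lemma psum_vec4: "psum d (vec4 p q r s) = p ^ d + q ^ d + r ^ d + s ^ d"
  by (simp add: psum_def sum_4)

text \<open>\<open>end_coeff\<close> and the two values of \<open>pair_coeff\<close> are the coefficients of the diagonal conic in
the plane through the line \<open>{(r, -r, s, -s)}\<close> and the point \<open>(p : p : q : q)\<close>.\<close>

definition end_coeff :: "complex \<Rightarrow> complex \<Rightarrow> complex \<Rightarrow> complex \<Rightarrow> complex \<Rightarrow> complex" where
  "end_coeff a b c p q = 8 * a * (p + q)^3 + 4 * b * (p + q) * (p^2 + q^2) + 2 * c * (p^3 + q^3)"

definition pair_coeff :: "complex \<Rightarrow> complex \<Rightarrow> complex \<Rightarrow> complex \<Rightarrow> complex" where
  "pair_coeff b c p q = 4 * b * (p + q) + 6 * c * p"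

text \<open>The identity behind the classification of lines. The conic is diagonal because the sign
of \<open>A\<close> can be changed by exchanging the first two coordinates, and that of \<open>B\<close> by exchanging the last two.\<close>

lemma sym_form_pairs:
  defines "x \<equiv> \<lambda>\<beta> A B p q. vec4 (\<beta> * p + A) (\<beta> * p - A) (\<beta> * q + B) (\<beta> * q - B)"
  shows "sym_form a b c (x \<beta> A B p q) (x \<beta> A B p q) (x \<beta> A B p q)
    = \<beta> * (\<beta>^2 * end_coeff a b c p q + A^2 * pair_coeff b c p q + B^2 * pair_coeff b c q p)"
proof -
  have 1: "psum 1 (x \<beta> A B p q) = 2 * \<beta> * (p + q)"
    unfolding x_def psum_vec4 by (simp add: algebra_simps)
  have 2: "psum 2 (x \<beta> A B p q) = 2 * (\<beta>^2 * (p^2 + q^2) + A^2 + B^2)"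
    unfolding x_def psum_vec4 by (simp add: power2_eq_square algebra_simps)
  have 3: "psum 3 (x \<beta> A B p q) = 2 * \<beta> * (\<beta>^2 * (p^3 + q^3) + 3 * (A^2 * p + B^2 * q))"
    unfolding x_def psum_vec4 by (simp add: power2_eq_square power3_eq_cube algebra_simps)
  show ?thesis
    unfolding sym_form_diag 1 2 3 end_coeff_def pair_coeff_def
    by (simp add: power2_eq_square power3_eq_cube algebra_simps)
qed

definition gradient :: "complex \<Rightarrow> complex \<Rightarrow> complex \<Rightarrow> complex^4 \<Rightarrow> 4 \<Rightarrow> complex" where
  "gradient a b c x i = 3 * a * psum 1 x ^ 2 + b * psum 2 x + 2 * b * psum 1 x * x $ i + 3 * c * (x $ i)^2"

lemma sym_form_gradient: "3 * sym_form a b c x x (axis i 1) = gradient a b c x i"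
proof -
  have "(\<Sum>l\<in>UNIV. axis i (1::complex) $ l) = 1"
    "(\<Sum>l\<in>UNIV. x $ l * axis i 1 $ l) = x $ i"
    "(\<Sum>l\<in>UNIV. x $ l * x $ l * axis i 1 $ l) = x $ i * x $ i"
    by (simp_all add: axis_def if_distrib[of "\<lambda>y. _ * y"] cong: if_cong)
  then show ?thesis
    by (simp add: sym_form_def gradient_def psum_def power2_eq_square algebra_simps)
qed

locale smooth_symmetric_cubic = smooth_cubic_form "sym_form a b c" for a b c
begin

lemma gradient_nonzero:
  assumes "x \<noteq> 0" shows "\<exists>i. gradient a b c x i \<noteq> 0"
proof (rule ccontr)
  assume "\<not> ?thesis"
  then have "sym_form a b c x x (axis i 1) = 0" for i
    using sym_form_gradient[of a b c x i] by simp
  then have "sym_form a b c x x y = 0" for y by (subst T_expand) simp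
  then show False using smooth assms by blast
qed

lemma gradient_nonzero_vec4:
  assumes "vec4 p q r s \<noteq> 0"
  shows "gradient a b c (vec4 p q r s) 1 \<noteq> 0 \<or> gradient a b c (vec4 p q r s) 2 \<noteq> 0
    \<or> gradient a b c (vec4 p q r s) 3 \<noteq> 0 \<or> gradient a b c (vec4 p q r s) 4 \<noteq> 0"
  using gradient_nonzero[OF assms] exhaust_4 by metis

lemma c_nonzero: "c \<noteq> 0"
proof
  assume "c = 0"
  then show False
    \<comment> \<open>At this point \<open>p\<^sub>1 = p\<^sub>2 = 0\<close>.\<close>
    using gradient_nonzero_vec4[of 1 \<i> "-1" "-\<i>"] by (simp add: gradient_def psum_vec4)
qed

lemma four_b_three_c_nonzero: "4 * b + 3 * c \<noteq> 0"
proof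
  assume "4 * b + 3 * c = 0"
  then show False
    using gradient_nonzero_vec4[of 1 "-1" 1 "-1"] by (simp add: gradient_def psum_vec4 algebra_simps)
qed

lemma sixteen_a_four_b_c_nonzero: "16 * a + 4 * b + c \<noteq> 0"
proof
  assume "16 * a + 4 * b + c = 0"
  moreover have "gradient a b c (vec4 1 1 1 1) i = 3 * (16 * a + 4 * b + c)" for i
    using exhaust_4[of i] by (auto simp: gradient_def psum_vec4 algebra_simps)
  ultimately show False
    using gradient_nonzero[of "vec4 1 1 1 1"] by simp
qed

lemma pair_coeff_sum:
  assumes "p + q = 1"
  shows "pair_coeff b c p q + pair_coeff b c q p \<noteq> 0"
proof
  assume "pair_coeff b c p q + pair_coeff b c q p = 0"
  then have "2 * (4 * b + 3 * c) = 0"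
    using assms unfolding pair_coeff_def by Groebner_Basis.algebra
  then show False using four_b_three_c_nonzero by (simp only: mult_eq_0_iff) simp
qed

text \<open>If both coefficients vanish, then the plane through the point \<open>(p : p : q : q)\<close> touches the surface along the line
\<open>B = 0\<close>, that is, along the points \<open>(p + A : p - A : q : q)\<close>. The gradient there has two pairs
of equal entries \<open>K + (2 b + 3 c) A\<^sup>2\<close> and \<open>L + 2 b A\<^sup>2\<close>, which are linked by Euler's relation, so a
suitable \<open>A\<close> makes all of them zero.\<close>

lemma end_coeff_nonzero:
  assumes pq: "p + q = 1" and P: "pair_coeff b c p q = 0"
  shows "end_coeff a b c p q \<noteq> 0"
proof
  assume C: "end_coeff a b c p q = 0"
  define K where "K = 12 * a + 2 * b * (p^2 + q^2) + 4 * b * p + 3 * c * p^2"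
  define L where "L = 12 * a + 2 * b * (p^2 + q^2) + 4 * b * q + 3 * c * q^2"
  have q: "q = 1 - p" using pq by (simp add: algebra_simps)
  have P': "4 * b = - 6 * c * p" using P pq by (simp add: pair_coeff_def add_eq_0_iff2)
  have KL: "p * K + q * L = 0"
  proof -
    have "2 * (p * K + q * L) = 3 * end_coeff a b c p q"
      unfolding K_def L_def end_coeff_def q
      by (simp add: power2_eq_square power3_eq_cube algebra_simps)
    then have "2 * (p * K + q * L) = 0" by (simp only: C mult_zero_right)
    then show ?thesis by (simp only: mult_eq_0_iff) simp
  qed
  have grad: "gradient a b c (vec4 (p + A) (p - A) q q) 1 = K + (2 * b + 3 * c) * A^2"
    "gradient a b c (vec4 (p + A) (p - A) q q) 2 = K + (2 * b + 3 * c) * A^2"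
    "gradient a b c (vec4 (p + A) (p - A) q q) 3 = L + 2 * b * A^2"
    "gradient a b c (vec4 (p + A) (p - A) q q) 4 = L + 2 * b * A^2" for A
  proof -
    have s: "psum 1 (vec4 (p + A) (p - A) q q) = 2" "psum 2 (vec4 (p + A) (p - A) q q) = 2 * (p^2 + q^2 + A^2)"
      unfolding psum_vec4 q by (simp_all add: power2_eq_square algebra_simps)
    show "gradient a b c (vec4 (p + A) (p - A) q q) 1 = K + (2 * b + 3 * c) * A^2"
      "gradient a b c (vec4 (p + A) (p - A) q q) 2 = K + (2 * b + 3 * c) * A^2"
      using P' unfolding gradient_def s K_def vec4_nth by Groebner_Basis.algebra+
    show "gradient a b c (vec4 (p + A) (p - A) q q) 3 = L + 2 * b * A^2"
      "gradient a b c (vec4 (p + A) (p - A) q q) 4 = L + 2 * b * A^2"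
      unfolding gradient_def s L_def by (simp_all add: power2_eq_square algebra_simps)
  qed
  \<comment> \<open>One entry is made zero by the choice of \<open>A\<close>; by Euler's relation the other one follows, if its factor \<open>p\<close> or \<open>q\<close> is not zero.\<close>
  have "\<exists>A. K + (2 * b + 3 * c) * A^2 = 0 \<and> L + 2 * b * A^2 = 0"
  proof (cases "q = 0")
    case True
    then have p: "p = 1" using pq by simp
    then have "b \<noteq> 0" using P' c_nonzero by auto
    then have "L + 2 * b * (csqrt (- L / (2 * b)))^2 = 0" by simp
    moreover have "K = 0" "2 * b + 3 * c = 0" using KL P' p True by auto
    ultimately show ?thesis by (intro exI[of _ "csqrt (- L / (2 * b))"]) (simp only: mult_zero_left add_0)
  next
    case False
    have ne: "2 * b + 3 * c \<noteq> 0"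
    proof
      assume "2 * b + 3 * c = 0"
      then have "6 * c * q = 0" using P' unfolding q by Groebner_Basis.algebra
      then show False using False c_nonzero by simp
    qed
    define A where "A = csqrt (- K / (2 * b + 3 * c))"
    have A: "K + (2 * b + 3 * c) * A^2 = 0" using ne by (simp add: A_def)
    have "q * (L + 2 * b * A^2) = (p * K + q * L) - p * (K + (2 * b + 3 * c) * A^2) + A^2 * ((4 * b + 6 * c * p) / 2)"
      unfolding q by (simp add: field_simps)
    also have "4 * b + 6 * c * p = 0" using P' by Groebner_Basis.algebra
    also have "(p * K + q * L) - p * (K + (2 * b + 3 * c) * A^2) + A^2 * (0 / 2) = 0"
      by (simp only: KL A) simp
    finally show ?thesis using A False by auto
  qed
  then obtain A where A: "K + (2 * b + 3 * c) * A^2 = 0" "L + 2 * b * A^2 = 0" by blast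
  have "vec4 (p + A) (p - A) q q \<noteq> 0"
  proof
    assume "vec4 (p + A) (p - A) q q = 0"
    then have "p + A = 0" "p - A = 0" "q = 0" by (simp_all only: vec4_eq_0_iff)
    then have "2 * p = 0" by Groebner_Basis.algebra
    then show False using pq \<open>q = 0\<close> by simp
  qed
  from gradient_nonzero_vec4[OF this] show False unfolding grad A by simp
qed

text \<open>Here \<open>pair_coeff b c p0 q0\<close> vanishes, and the conic degenerates to the two lines \<open>B = \<plusminus> z0 \<beta>\<close>, which meet in the
Eckardt point \<open>(1 : -1 : 0 : 0)\<close>.\<close>

definition "p0 = - 2 * b / (3 * c)"
definition "q0 = 1 - p0"
definition "z0 = csqrt (- end_coeff a b c p0 q0 / pair_coeff b c q0 p0)"

lemma eckardt_parameters:
  "p0 + q0 = 1" "pair_coeff b c p0 q0 = 0" "pair_coeff b c q0 p0 \<noteq> 0"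
  "end_coeff a b c p0 q0 + z0^2 * pair_coeff b c q0 p0 = 0" "z0 \<noteq> 0"
proof -
  show 1: "p0 + q0 = 1" by (simp add: q0_def)
  show 2: "pair_coeff b c p0 q0 = 0" unfolding pair_coeff_def 1 using c_nonzero by (simp add: p0_def)
  show 3: "pair_coeff b c q0 p0 \<noteq> 0" using pair_coeff_sum[OF 1] 2 by simp
  then show "end_coeff a b c p0 q0 + z0^2 * pair_coeff b c q0 p0 = 0" by (simp add: z0_def)
  then show "z0 \<noteq> 0" using end_coeff_nonzero[OF 1 2] by auto
qed

text \<open>Here \<open>end_coeff a b c p1 q1\<close> vanishes: with \<open>p + q = 1\<close> this is a quadratic equation for \<open>p\<close>, symmetric in
\<open>p\<close> and \<open>q\<close>. The conic degenerates to the two lines \<open>A = \<plusminus> r1 B\<close>.\<close>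

definition "p1 = (1 + csqrt (1 - 4 * ((4 * a + 2 * b + c) / (4 * b + 3 * c)))) / 2"
definition "q1 = 1 - p1"
definition "r1 = csqrt (- pair_coeff b c q1 p1 / pair_coeff b c p1 q1)"

lemma end_coeff_normalized:
  assumes "p + q = 1"
  shows "end_coeff a b c p q = 2 * (4 * a + 2 * b + c) - 2 * (4 * b + 3 * c) * (p * q)"
proof -
  have q: "q = 1 - p" using assms by (simp add: algebra_simps)
  show ?thesis unfolding end_coeff_def q
    by (simp add: power2_eq_square power3_eq_cube algebra_simps)
qed

lemma crossing_parameters:
  "p1 + q1 = 1" "p1 \<noteq> q1" "end_coeff a b c p1 q1 = 0"
  "pair_coeff b c p1 q1 \<noteq> 0" "pair_coeff b c q1 p1 \<noteq> 0"
  "r1^2 * pair_coeff b c p1 q1 + pair_coeff b c q1 p1 = 0"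
proof -
  define m where "m = (4 * a + 2 * b + c) / (4 * b + 3 * c)"
  have m: "(4 * b + 3 * c) * m = 4 * a + 2 * b + c" using four_b_three_c_nonzero by (simp add: m_def)
  define d where "d = csqrt (1 - 4 * m)"
  have d: "d^2 = 1 - 4 * m" by (simp add: d_def)
  have p: "p1 = (1 + d) / 2" by (simp add: p1_def d_def m_def)
  have q: "q1 = (1 - d) / 2" by (simp add: q1_def p field_simps)
  show 1: "p1 + q1 = 1" by (simp add: q1_def)
  have "p1 * q1 = (1 - d^2) / 4" by (simp add: p q power2_eq_square field_simps)
  then have pq: "p1 * q1 = m" by (simp add: d)
  show E: "end_coeff a b c p1 q1 = 0"
    unfolding end_coeff_normalized[OF 1] pq by (simp only: mult.assoc m) simp
  show "p1 \<noteq> q1"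
  proof
    assume "p1 = q1"
    then have "d = 0" by (simp add: p q)
    then have "4 * m = 1" using d by simp
    then have "16 * a + 4 * b + c = 0" using m by Groebner_Basis.algebra
    then show False using sixteen_a_four_b_c_nonzero by simp
  qed
  show "pair_coeff b c p1 q1 \<noteq> 0" using end_coeff_nonzero[OF 1] E by auto
  then show "r1^2 * pair_coeff b c p1 q1 + pair_coeff b c q1 p1 = 0"
    by (simp add: r1_def)
  have "end_coeff a b c q1 p1 = 0" using E by (simp add: end_coeff_def add.commute)
  then show "pair_coeff b c q1 p1 \<noteq> 0" using end_coeff_nonzero[of q1 p1] 1 by (auto simp: add.commute)
qed

text \<open>The coordinates \<open>r1, 1, -r1, -1\<close> of the point in which the line meets \<open>p\<^sub>1 = 0\<close> are distinct, and
multiplication by \<open>\<i>\<close> does not permute them.\<close>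

lemma r1_generic: "r1 \<noteq> 0" "r1^2 \<noteq> 1" "r1^2 \<noteq> - 1"
proof -
  show "r1 \<noteq> 0" using crossing_parameters(5,6) by auto
  have diff: "pair_coeff b c p1 q1 - pair_coeff b c q1 p1 = 6 * c * (p1 - q1)"
    by (simp add: pair_coeff_def algebra_simps)
  show "r1^2 \<noteq> 1"
  proof
    assume "r1^2 = 1"
    then show False using crossing_parameters(6) pair_coeff_sum[OF crossing_parameters(1)] by simp
  qed
  show "r1^2 \<noteq> - 1"
  proof
    assume "r1^2 = - 1"
    then have "6 * c * (p1 - q1) = 0" using diff crossing_parameters(6) by Groebner_Basis.algebra
    then show False using c_nonzero crossing_parameters(2) by simp
  qed
qed

end

section \<open>Three lines that represent all others\<close>

lemma perm_vec_transpose: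
  "perm_vec (Transposition.transpose i j) x $ k = x $ Transposition.transpose i j k"
  by (simp add: inv_equality)

lemma perm_vec4 [simp]:
  "perm_vec (Transposition.transpose 1 2) (vec4 p q r s) = vec4 q p r s"
  "perm_vec (Transposition.transpose 3 4) (vec4 p q r s) = vec4 p q s r"
  "perm_vec (Transposition.transpose 2 3) (vec4 p q r s) = vec4 p r q s"
  "perm_vec (Transposition.transpose 2 4) (vec4 p q r s) = vec4 p s r q"
  "perm_vec (Transposition.transpose 1 3) (vec4 p q r s) = vec4 r q p s"
  by (rule vec4_eqI; simp add: perm_vec_transpose Transposition.transpose_def del: perm_vec_nth)+

definition swap_pairs :: "4 \<Rightarrow> 4" where
  "swap_pairs = Transposition.transpose 1 3 \<circ> Transposition.transpose 2 4"

lemma bij_swap_pairs: "bij swap_pairs"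
  by (simp add: swap_pairs_def bij_comp)

lemma perm_vec4_swap_pairs [simp]: "perm_vec swap_pairs (vec4 p q r s) = vec4 r s p q"
  by (simp add: swap_pairs_def flip: perm_vec_comp)

lemma span_pair_scale:
  fixes u v :: "complex^'n::finite"
  assumes "k \<noteq> 0" shows "vec.span {u, k *s v} = vec.span {u, v}"
proof (intro Set.set_eqI iffI)
  fix x assume "x \<in> vec.span {u, k *s v}"
  then obtain \<alpha> \<beta> where "x = \<alpha> *s u + \<beta> *s (k *s v)" unfolding span_pair_iff by blast
  then have "x = \<alpha> *s u + (\<beta> * k) *s v" by simp
  then show "x \<in> vec.span {u, v}" unfolding span_pair_iff by blast
next
  fix x assume "x \<in> vec.span {u, v}"
  then obtain \<alpha> \<beta> where "x = \<alpha> *s u + \<beta> *s v" unfolding span_pair_iff by blast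
  then have "x = \<alpha> *s u + (\<beta> / k) *s (k *s v)" using assms by simp
  then show "x \<in> vec.span {u, k *s v}" unfolding span_pair_iff by blast
qed

lemma span_pair_nonzero:
  fixes u v :: "complex^'n::finite"
  assumes "vec.dim (vec.span {u, v}) = 2" shows "u \<noteq> 0"
proof
  assume "u = 0"
  then have "vec.span {u, v} \<subseteq> vec.span {v}" by (simp add: vec.span_insert_0)
  then have "vec.dim (vec.span {u, v}) \<le> card {v}" by (rule vec.dim_le_card) simp
  then show False unfolding assms by simp
qed

text \<open>For \<open>i \<noteq> j\<close> this plane is given by \<open>x\<^sub>i + x\<^sub>j = 0 = x\<^sub>k + x\<^sub>l\<close>, with \<open>k\<close>, \<open>l\<close> the other two indices.\<close>

definition opposite_plane :: "4 \<Rightarrow> 4 \<Rightarrow> (complex^4) set" where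
  "opposite_plane i j = {x. psum 1 x = 0 \<and> x $ i + x $ j = 0}"

lemma psum_perm:
  assumes "bij \<sigma>" shows "psum d (perm_vec \<sigma> x) = psum d x"
  unfolding psum_def perm_vec_nth
  by (rule sum.reindex_bij_betw[OF bij_imp_bij_inv[OF assms]])

lemma opposite_plane_perm:
  assumes "bij \<sigma>"
  shows "perm_vec \<sigma> ` opposite_plane i j = opposite_plane (\<sigma> i) (\<sigma> j)"
proof (intro Set.set_eqI iffI)
  fix x assume "x \<in> perm_vec \<sigma> ` opposite_plane i j"
  then show "x \<in> opposite_plane (\<sigma> i) (\<sigma> j)"
    using assms by (auto simp: opposite_plane_def psum_perm bij_is_inj)
next
  fix x assume x: "x \<in> opposite_plane (\<sigma> i) (\<sigma> j)"
  have "perm_vec (inv_into UNIV \<sigma>) x \<in> opposite_plane i j"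
    using x assms by (simp add: opposite_plane_def psum_perm bij_imp_bij_inv inv_inv_eq)
  then show "x \<in> perm_vec \<sigma> ` opposite_plane i j"
    by (metis assms image_eqI perm_vec_inv(1))
qed

lemma opposite_plane_12: "opposite_plane 1 2 = vec.span {vec4 1 (-1) 0 0, vec4 0 0 1 (-1)}"
proof (intro Set.set_eqI iffI)
  fix x assume x: "x \<in> opposite_plane 1 2"
  then have "x $ 2 = - (x $ 1)" "x $ 4 = - (x $ 3)"
    by (simp_all add: opposite_plane_def psum_def sum_4 add_eq_0_iff)
  then have "x = x $ 1 *s vec4 1 (-1) 0 0 + x $ 3 *s vec4 0 0 1 (-1)"
    by (simp add: vec_eq_iff forall_4)
  then show "x \<in> vec.span {vec4 1 (-1) 0 0, vec4 0 0 1 (-1)}" unfolding span_pair_iff by blast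
next
  fix x assume "x \<in> vec.span {vec4 1 (-1) 0 0, vec4 0 0 1 (-1)}"
  then show "x \<in> opposite_plane 1 2"
    unfolding span_pair_iff by (auto simp: opposite_plane_def psum_vec4)
qed

lemma vec4_opposite_plane [simp]: "vec4 p q r s \<in> opposite_plane 1 2 \<longleftrightarrow> p + q = 0 \<and> r + s = 0"
proof -
  have "p + q + r + s = (p + q) + (r + s)" by simp
  then show ?thesis unfolding opposite_plane_def mem_Collect_eq psum_vec4 power_one_right vec4_nth by auto
qed

context smooth_symmetric_cubic
begin

text \<open>The coordinates are ordered such that the stabilizers will be exactly \<open>C2\<close> and \<open>C2'\<close>. For this reason the pairs
of coordinates in \<open>crossing_plane\<close> are \<open>{1, 3}\<close> and \<open>{2, 4}\<close>, instead of \<open>{1, 2}\<close> and \<open>{3, 4}\<close> as in \<open>sym_form_pairs\<close>.\<close>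

definition "eckardt_plane = vec.span {vec4 1 (-1) 0 0, vec4 p0 p0 (q0 + z0) (q0 - z0)}"
definition "crossing_plane = vec.span {vec4 r1 1 (-r1) (-1), vec4 p1 q1 p1 q1}"

definition "base_planes = {opposite_plane 1 2, eckardt_plane, crossing_plane}"

lemma base_planes_dim:
  assumes "V \<in> base_planes" shows "vec.subspace V" "vec.dim V = 2"
proof -
  have "vec.dim (vec.span {vec4 1 (-1) 0 0, vec4 0 0 1 (-1)}) = 2"
    by (rule dim_span_pair) simp_all
  moreover have "vec.dim eckardt_plane = 2"
    unfolding eckardt_plane_def
  proof (rule dim_span_pair)
    show "vec4 p0 p0 (q0 + z0) (q0 - z0) \<noteq> k *s vec4 1 (-1) 0 0" for k
      using eckardt_parameters(5) by auto
  qed simp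
  moreover have "vec.dim crossing_plane = 2"
    unfolding crossing_plane_def
  proof (rule dim_span_pair)
    show "vec4 p1 q1 p1 q1 \<noteq> k *s vec4 r1 1 (-r1) (-1)" for k
    proof
      assume *: "vec4 p1 q1 p1 q1 = k *s vec4 r1 1 (-r1) (-1)"
      then have "p1 = k * r1 \<and> q1 = k * 1 \<and> p1 = k * - r1 \<and> q1 = k * - 1"
        unfolding vec4_scale vec4_eq_iff .
      then have "p1 = k * r1" "p1 = k * - r1" "q1 = k * 1" "q1 = k * - 1" by blast+
      then have "2 * p1 = 0" "2 * q1 = 0" by Groebner_Basis.algebra+
      then show False using crossing_parameters(1) by simp
    qed
  qed simp
  ultimately show "vec.dim V = 2" using assms by (auto simp: base_planes_def opposite_plane_12)
  show "vec.subspace V"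
    using assms by (auto simp: base_planes_def opposite_plane_12 eckardt_plane_def crossing_plane_def)
qed

definition moves_to_base :: "(complex^4) set \<Rightarrow> bool" where
  "moves_to_base W \<longleftrightarrow> (\<exists>\<sigma>. bij \<sigma> \<and> perm_vec \<sigma> ` W \<in> base_planes)"

lemma moves_to_base_perm:
  assumes "bij \<tau>" "moves_to_base (perm_vec \<tau> ` W)" shows "moves_to_base W"
  using assms unfolding moves_to_base_def by (metis perm_vec_image_comp bij_comp)

lemma moves_to_baseI:
  assumes "vec.dim W = 2" "W = vec.span {v, w}" "bij \<sigma>" "V \<in> base_planes"
    "perm_vec \<sigma> v \<in> V" "perm_vec \<sigma> w \<in> V"
  shows "moves_to_base W"
proof -
  have "perm_vec \<sigma> ` W = V"
  proof (rule plane_eqI)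
    show "perm_vec \<sigma> ` W \<subseteq> V"
      unfolding assms(2) span_perm_image by (rule vec.span_minimal) (use assms base_planes_dim in auto)
  qed (use assms base_planes_dim in \<open>simp_all add: subspace_perm_image dim_perm_image\<close>)
  then show ?thesis using assms unfolding moves_to_base_def by blast
qed

text \<open>The first square is absent from the conic, so \<open>p = p0\<close>. Then \<open>s = 0\<close>, and \<open>z\<close> is determined up to the
sign, which the transposition of the last two coordinates changes.\<close>

lemma moves_to_base_eckardt:
  assumes dim: "vec.dim W = 2"
    and W: "W = vec.span {vec4 r (-r) s (-s), vec4 (p + t) (p - t) (q + z) (q - z)}"
    and pq: "p + q = 1" and P: "pair_coeff b c p q = 0"
    and E: "r^2 * pair_coeff b c p q + s^2 * pair_coeff b c q p = 0"
      "end_coeff a b c p q + t^2 * pair_coeff b c p q + z^2 * pair_coeff b c q p = 0"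
  shows "moves_to_base W"
proof -
  have "6 * c * (p - p0) = 0"
    using P eckardt_parameters(2) pq eckardt_parameters(1) unfolding pair_coeff_def by Groebner_Basis.algebra
  then have p: "p = p0" using c_nonzero by simp
  then have q: "q = q0" using pq eckardt_parameters(1) by (metis add_left_cancel)
  have s: "s = 0" using E(1) P eckardt_parameters(3) p q by simp
  have "(z^2 - z0^2) * pair_coeff b c q0 p0 = 0"
    using E(2) P eckardt_parameters(4) unfolding p q by Groebner_Basis.algebra
  then have "z^2 = z0^2" using eckardt_parameters(3) by simp
  then consider "z = z0" | "z = - z0" by (auto simp: power2_eq_iff)
  then show ?thesis
  proof cases
    case 1
    show ?thesis
    proof (rule moves_to_baseI[OF dim W])
      show "perm_vec id (vec4 r (-r) s (-s)) \<in> eckardt_plane"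
        unfolding eckardt_plane_def span_pair_iff by (rule exI[of _ r], rule exI[of _ 0]) (simp add: s)
      show "perm_vec id (vec4 (p + t) (p - t) (q + z) (q - z)) \<in> eckardt_plane"
        unfolding eckardt_plane_def span_pair_iff by (rule exI[of _ t], rule exI[of _ 1]) (simp add: p q 1)
    qed (simp_all add: base_planes_def)
  next
    case 2
    show ?thesis
    proof (rule moves_to_baseI[OF dim W])
      show "perm_vec (Transposition.transpose 3 4) (vec4 r (-r) s (-s)) \<in> eckardt_plane"
        unfolding eckardt_plane_def span_pair_iff by (rule exI[of _ r], rule exI[of _ 0]) (simp add: s)
      show "perm_vec (Transposition.transpose 3 4) (vec4 (p + t) (p - t) (q + z) (q - z)) \<in> eckardt_plane"
        unfolding eckardt_plane_def span_pair_iff by (rule exI[of _ t], rule exI[of _ 1]) (simp add: p q 2)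
    qed (simp_all add: base_planes_def)
  qed
qed

text \<open>The ratio \<open>r : s\<close> is determined up to the sign, which the transposition of the first two coordinates changes.\<close>

lemma moves_to_base_crossing:
  assumes dim: "vec.dim W = 2"
    and W: "W = vec.span {vec4 r (-r) s (-s), vec4 (p1 + k * r) (p1 - k * r) (q1 + k * s) (q1 - k * s)}"
    and E: "r^2 * pair_coeff b c p1 q1 + s^2 * pair_coeff b c q1 p1 = 0"
  shows "moves_to_base W"
proof -
  have *: "moves_to_base W" if dim: "vec.dim W = 2" and r: "r = r1 * s"
    and W: "W = vec.span {vec4 r (-r) s (-s), vec4 (p1 + k * r) (p1 - k * r) (q1 + k * s) (q1 - k * s)}" for W r k
  proof (rule moves_to_baseI[OF dim W])
    show "perm_vec (Transposition.transpose 2 3) (vec4 r (-r) s (-s)) \<in> crossing_plane"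
      unfolding crossing_plane_def span_pair_iff by (rule exI[of _ s], rule exI[of _ 0]) (simp add: r)
    show "perm_vec (Transposition.transpose 2 3) (vec4 (p1 + k * r) (p1 - k * r) (q1 + k * s) (q1 - k * s)) \<in> crossing_plane"
      unfolding crossing_plane_def span_pair_iff by (rule exI[of _ "k * s"], rule exI[of _ 1]) (simp add: r)
  qed (simp_all add: base_planes_def)
  have "(r^2 - (r1 * s)^2) * pair_coeff b c p1 q1 = 0"
    using E crossing_parameters(6) by Groebner_Basis.algebra
  then have "r^2 = (r1 * s)^2" using crossing_parameters(4) by simp
  then consider "r = r1 * s" | "r = - (r1 * s)" by (auto simp: power2_eq_iff)
  then show ?thesis
  proof cases
    case 1
    then show ?thesis using *[OF dim _ W] by blast
  next
    case 2
    let ?W = "perm_vec (Transposition.transpose 1 2) ` W"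
    have "moves_to_base ?W"
    proof (rule *)
      show "vec.dim ?W = 2" using dim by (simp add: dim_perm_image)
      show "r1 * s = r1 * s" ..
      show "?W = vec.span {vec4 (r1 * s) (-(r1 * s)) s (-s), vec4 (p1 + k * (r1 * s)) (p1 - k * (r1 * s)) (q1 + k * s) (q1 - k * s)}"
        unfolding W span_perm_image by (simp add: 2)
    qed
    then show ?thesis by (rule moves_to_base_perm[rotated]) simp
  qed
qed

lemma swap_pairs_plane:
  assumes "W = vec.span {vec4 r (-r) s (-s), vec4 (p + t) (p - t) (q + z) (q - z)}"
  shows "perm_vec swap_pairs ` W = vec.span {vec4 s (-s) r (-r), vec4 (q + z) (q - z) (p + t) (p - t)}"
  unfolding assms span_perm_image by simp

text \<open>Outside the hyperplane \<open>p\<^sub>1 = 0\<close> one has \<open>p + q \<noteq> 0\<close>, and the generator may be scaled to \<open>p + q = 1\<close>. The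
three equations say that the line lies on the conic. If the coefficients of both squares are nonzero, they imply
that \<open>(t, z)\<close> is a multiple of \<open>(r, s)\<close>, hence that \<open>end_coeff\<close> vanishes. The permutation \<open>swap_pairs\<close>
exchanges the roles of \<open>p\<close> and \<open>q\<close>.\<close>

lemma moves_to_base_transversal:
  assumes dim: "vec.dim W = 2"
    and W: "W = vec.span {vec4 r (-r) s (-s), vec4 (p + t) (p - t) (q + z) (q - z)}"
    and pq: "p + q = 1"
    and E: "r^2 * pair_coeff b c p q + s^2 * pair_coeff b c q p = 0"
      "r * t * pair_coeff b c p q + s * z * pair_coeff b c q p = 0"
      "end_coeff a b c p q + t^2 * pair_coeff b c p q + z^2 * pair_coeff b c q p = 0"
  shows "moves_to_base W"
proof -
  have dim': "vec.dim (perm_vec swap_pairs ` W) = 2" using dim by (simp add: dim_perm_image bij_swap_pairs)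
  have sym: "end_coeff a b c q p = end_coeff a b c p q" by (simp add: end_coeff_def add.commute)
  consider "pair_coeff b c p q = 0" | "pair_coeff b c q p = 0"
    | "pair_coeff b c p q \<noteq> 0" "pair_coeff b c q p \<noteq> 0" by blast
  then show ?thesis
  proof cases
    case 1
    then show ?thesis using moves_to_base_eckardt[OF dim W pq _ E(1,3)] by blast
  next
    case 2
    have "moves_to_base (perm_vec swap_pairs ` W)"
      by (rule moves_to_base_eckardt[OF dim' swap_pairs_plane[OF W] _ 2])
        (use pq E(1,3) in \<open>simp_all add: sym ac_simps\<close>)
    then show ?thesis by (rule moves_to_base_perm[OF bij_swap_pairs])
  next
    case 3
    have "vec4 r (-r) s (-s) \<noteq> 0" using dim unfolding W by (rule span_pair_nonzero)
    then have r: "r \<noteq> 0" and s: "s \<noteq> 0" using E(1) 3 by auto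
    have "s * pair_coeff b c q p * (r * z - t * s) = 0"
      using E(1,2) by Groebner_Basis.algebra
    then have rz: "r * z = t * s" using 3 s by simp
    define k where "k = t / r"
    have t: "t = k * r" and z: "z = k * s" using r rz by (simp_all add: k_def field_simps)
    have "end_coeff a b c p q = 0"
      using E(1,3) unfolding t z by Groebner_Basis.algebra
    then have "2 * (4 * b + 3 * c) * (p * q - p1 * q1) = 0"
      using crossing_parameters(3) unfolding end_coeff_normalized[OF pq] end_coeff_normalized[OF crossing_parameters(1)]
      by Groebner_Basis.algebra
    then have "p * q = p1 * q1" using four_b_three_c_nonzero by (simp only: mult_eq_0_iff) simp
    then have "(p - p1) * (p - q1) = 0" using pq crossing_parameters(1) by Groebner_Basis.algebra
    then consider "p = p1" | "p = q1" by auto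
    then show ?thesis
    proof cases
      case 1
      then have q: "q = q1" using pq crossing_parameters(1) by (metis add_left_cancel)
      show ?thesis by (rule moves_to_base_crossing[OF dim]) (use W E(1) in \<open>simp_all add: 1 q t z\<close>)
    next
      case 2
      then have q: "q = p1" using pq crossing_parameters(1) by (metis add_left_cancel add.commute)
      have "moves_to_base (perm_vec swap_pairs ` W)"
        by (rule moves_to_base_crossing[OF dim', of s r k])
          (use swap_pairs_plane[OF W] E(1) in \<open>simp_all add: 2 q t z add.commute\<close>)
      then show ?thesis by (rule moves_to_base_perm[OF bij_swap_pairs])
    qed
  qed
qed

text \<open>The case of lines in the hyperplane \<open>p\<^sub>1 = 0\<close>.\<close>

lemma moves_to_base_opposite:
  assumes dim: "vec.dim W = 2"
    and W: "W = vec.span {vec4 r (-r) s (-s), vec4 (p + t) (p - t) (q + z) (q - z)}"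
    and pq: "p + q = 0"
    and E: "r^2 * pair_coeff b c p q + s^2 * pair_coeff b c q p = 0"
      "r * t * pair_coeff b c p q + s * z * pair_coeff b c q p = 0"
  shows "moves_to_base W"
proof -
  have base: "opposite_plane 1 2 \<in> base_planes" by (simp add: base_planes_def)
  have q: "q = - p" using pq by (simp add: add_eq_0_iff)
  show ?thesis
  proof (cases "p = 0")
    case True
    show ?thesis by (rule moves_to_baseI[OF dim W bij_id base]) (simp_all add: True q)
  next
    case False
    have "vec4 r (-r) s (-s) \<noteq> 0" using dim unfolding W by (rule span_pair_nonzero)
    have "6 * c * p * (r^2 - s^2) = 0" "6 * c * p * (r * t - s * z) = 0"
      using E unfolding pair_coeff_def q by Groebner_Basis.algebra+
    then have rs: "r^2 = s^2" and rt: "r * t = s * z" using False c_nonzero by simp_all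
    from rs consider "s = r" | "s = - r" by (auto simp: power2_eq_iff)
    then show ?thesis
    proof cases
      case 1
      then have "r \<noteq> 0" using \<open>vec4 r (-r) s (-s) \<noteq> 0\<close> by auto
      then have "z = t" using rt 1 by simp
      then show ?thesis
        by (intro moves_to_baseI[OF dim W _ base, of "Transposition.transpose 2 4"]) (simp_all add: 1 q)
    next
      case 2
      then have "r \<noteq> 0" using \<open>vec4 r (-r) s (-s) \<noteq> 0\<close> by auto
      moreover have "r * (t + z) = 0" using rt 2 by Groebner_Basis.algebra
      ultimately have "z = - t" by (simp add: add_eq_0_iff)
      then show ?thesis
        by (intro moves_to_baseI[OF dim W _ base, of "Transposition.transpose 2 3"]) (simp_all add: 2 q)
    qed
  qed
qed

lemma line_equations:
  assumes W: "W = vec.span {vec4 r (-r) s (-s), vec4 (p + t) (p - t) (q + z) (q - z)}"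
    and zero: "\<And>x. x \<in> W \<Longrightarrow> sym_form a b c x x x = 0"
  shows "r^2 * pair_coeff b c p q + s^2 * pair_coeff b c q p = 0"
    "r * t * pair_coeff b c p q + s * z * pair_coeff b c q p = 0"
    "end_coeff a b c p q + t^2 * pair_coeff b c p q + z^2 * pair_coeff b c q p = 0"
proof -
  have E: "end_coeff a b c p q + (\<alpha> * r + t)^2 * pair_coeff b c p q + (\<alpha> * s + z)^2 * pair_coeff b c q p = 0" for \<alpha>
  proof -
    have "vec4 (p + (\<alpha> * r + t)) (p - (\<alpha> * r + t)) (q + (\<alpha> * s + z)) (q - (\<alpha> * s + z)) \<in> W"
      unfolding W span_pair_iff
      by (rule exI[of _ \<alpha>], rule exI[of _ 1]) (simp add: algebra_simps)
    from zero[OF this] show ?thesis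
      using sym_form_pairs[of a b c 1 p "\<alpha> * r + t" q "\<alpha> * s + z"] by simp
  qed
  have E0: "end_coeff a b c p q + t^2 * pair_coeff b c p q + z^2 * pair_coeff b c q p = 0"
    using E[of 0] by simp
  have E1: "end_coeff a b c p q + (r + t)^2 * pair_coeff b c p q + (s + z)^2 * pair_coeff b c q p = 0"
    using E[of 1] by simp
  have E2: "end_coeff a b c p q + (t - r)^2 * pair_coeff b c p q + (z - s)^2 * pair_coeff b c q p = 0"
    using E[of "-1"] by simp
  have "2 * (r^2 * pair_coeff b c p q + s^2 * pair_coeff b c q p) = 0"
    using E0 E1 E2 by Groebner_Basis.algebra
  moreover have "4 * (r * t * pair_coeff b c p q + s * z * pair_coeff b c q p) = 0"
    using E1 E2 by Groebner_Basis.algebra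
  ultimately show "r^2 * pair_coeff b c p q + s^2 * pair_coeff b c q p = 0"
    "r * t * pair_coeff b c p q + s * z * pair_coeff b c q p = 0"
    by (simp_all only: mult_eq_0_iff zero_neq_numeral[symmetric] simp_thms)
  show "end_coeff a b c p q + t^2 * pair_coeff b c p q + z^2 * pair_coeff b c q p = 0" by (rule E0)
qed

text \<open>Every vector has the form \<open>(p + t, p - t, q + z, q - z)\<close>, so the second generator imposes no restriction.\<close>

lemma moves_to_base_meeting_12:
  assumes W: "vec.subspace W" "vec.dim W = 2" and zero: "\<And>x. x \<in> W \<Longrightarrow> sym_form a b c x x x = 0"
    and v: "v \<in> W" "v \<noteq> 0" "psum 1 v = 0" "v $ 1 + v $ 2 = 0"
  shows "moves_to_base W"
proof -
  define r s where "r = v $ 1" and "s = v $ 3"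
  have "v $ 3 + v $ 4 = 0" using v(3,4) by (simp add: psum_def sum_4)
  then have v_eq: "v = vec4 r (-r) s (-s)"
    using v(4) by (intro vec4_eqI) (simp_all add: r_def s_def add_eq_0_iff)
  obtain w where w: "W = vec.span {v, w}" using plane_eq_span[OF W v(1,2)] by blast
  define p t q z where "p = (w $ 1 + w $ 2) / 2" and "t = (w $ 1 - w $ 2) / 2"
    and "q = (w $ 3 + w $ 4) / 2" and "z = (w $ 3 - w $ 4) / 2"
  have "w = vec4 (p + t) (p - t) (q + z) (q - z)"
    by (rule vec4_eqI) (simp_all add: p_def t_def q_def z_def field_simps)
  then have W_eq: "W = vec.span {vec4 r (-r) s (-s), vec4 (p + t) (p - t) (q + z) (q - z)}"
    using w v_eq by simp
  show ?thesis
  proof (cases "p + q = 0")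
    case True
    then show ?thesis using moves_to_base_opposite[OF W(2) W_eq _ line_equations(1,2)[OF W_eq zero]] by blast
  next
    case False
    define n where "n = 1 / (p + q)"
    have n: "n * p + n * q = 1" using False by (simp add: n_def flip: add_divide_distrib)
    have "n \<noteq> 0" using False by (simp add: n_def)
    have scale: "n *s vec4 (p + t) (p - t) (q + z) (q - z)
        = vec4 (n * p + n * t) (n * p - n * t) (n * q + n * z) (n * q - n * z)"
      by (simp add: algebra_simps)
    have W_eq': "W = vec.span {vec4 r (-r) s (-s),
        vec4 (n * p + n * t) (n * p - n * t) (n * q + n * z) (n * q - n * z)}"
      unfolding W_eq scale[symmetric] by (rule span_pair_scale[OF \<open>n \<noteq> 0\<close>, symmetric])
    show ?thesis by (rule moves_to_base_transversal[OF W(2) W_eq' n line_equations[OF W_eq' zero]])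
  qed
qed

lemma psum3_factor:
  assumes "psum 1 x = 0"
  shows "psum 3 x = 3 * (x $ 1 + x $ 2) * (x $ 1 + x $ 3) * (x $ 1 + x $ 4)"
  using assms unfolding psum_def sum_4 by Groebner_Basis.algebra

theorem every_line_moves_to_base:
  assumes W: "vec.subspace W" "vec.dim W = 2" and zero: "\<And>x. x \<in> W \<Longrightarrow> sym_form a b c x x x = 0"
  shows "moves_to_base W"
proof -
  obtain v where v: "v \<in> W" "v \<noteq> 0" "psum 1 v = 0"
    using plane_meets_hyperplane[OF W, of "psum 1"] by (auto simp: psum_def sum.distrib sum_distrib_left)
  have "sym_form a b c v v v = 0" by (rule zero[OF v(1)])
  then have "psum 3 v = 0" using v(3) c_nonzero by (simp add: sym_form_diag)
  then have "v $ 1 + v $ 2 = 0 \<or> v $ 1 + v $ 3 = 0 \<or> v $ 1 + v $ 4 = 0"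
    using psum3_factor[OF v(3)] by (simp only: mult_eq_0_iff eq_commute[of 0]) simp
  then obtain j where j: "j \<noteq> 1" "v $ 1 + v $ j = 0"
  proof (elim disjE)
  qed (rule that; simp)+
  let ?\<tau> = "Transposition.transpose 2 j"
  have "moves_to_base (perm_vec ?\<tau> ` W)"
  proof (rule moves_to_base_meeting_12)
    show "vec.subspace (perm_vec ?\<tau> ` W)" "vec.dim (perm_vec ?\<tau> ` W) = 2"
      using W by (simp_all add: subspace_perm_image dim_perm_image)
    show "sym_form a b c x x x = 0" if "x \<in> perm_vec ?\<tau> ` W" for x
      using that zero by (auto simp: sym_form_perm)
    show "perm_vec ?\<tau> v \<in> perm_vec ?\<tau> ` W" using v by simp
    show "perm_vec ?\<tau> v \<noteq> 0" using v by (simp add: perm_vec_eq_0_iff)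
    show "psum 1 (perm_vec ?\<tau> v) = 0" using v by (simp add: psum_perm)
    show "perm_vec ?\<tau> v $ 1 + perm_vec ?\<tau> v $ 2 = 0"
      using j by (simp add: perm_vec_transpose Transposition.transpose_def del: perm_vec_nth)
  qed
  then show ?thesis by (rule moves_to_base_perm[rotated]) simp
qed

end

section \<open>Stabilizers\<close>

lemma perm_plane_eqI:
  fixes V :: "(complex^4) set"
  assumes "vec.dim V = 2" "V = vec.span {u, w}" "bij \<sigma>" "perm_vec \<sigma> u \<in> V" "perm_vec \<sigma> w \<in> V"
  shows "perm_vec \<sigma> ` V = V"
proof (rule plane_eqI)
  have V: "vec.subspace V" unfolding assms(2) by (rule vec.subspace_span)
  then show "vec.subspace (perm_vec \<sigma> ` V)" "vec.subspace V" by (simp_all add: subspace_perm_image)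
  show "vec.dim (perm_vec \<sigma> ` V) = 2" "vec.dim V = 2" using assms by (simp_all add: dim_perm_image)
  have "vec.span {perm_vec \<sigma> u, perm_vec \<sigma> w} \<subseteq> V" using assms(4,5) V by (intro vec.span_minimal) auto
  then show "perm_vec \<sigma> ` V \<subseteq> V" using span_perm_image[of \<sigma> u w] assms(2) by simp
qed

lemma bij_eq_if_inv_eq:
  assumes "bij \<sigma>" "\<And>k. inv_into UNIV \<sigma> k = \<tau> k" "\<And>k. \<tau> (\<tau> k) = k"
  shows "\<sigma> = \<tau>"
proof
  fix k
  show "\<sigma> k = \<tau> k" using assms by (metis bij_inv_eq_iff)
qed

lemma swap_pairs_values [simp]: "swap_pairs 1 = 3" "swap_pairs 2 = 4" "swap_pairs 3 = 1" "swap_pairs 4 = 2"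
  by (simp_all add: swap_pairs_def Transposition.transpose_def)

lemma swap_pairs_involution: "swap_pairs (swap_pairs k) = k"
  using exhaust_4[of k] by auto

lemma swap_pairs_no_fixed_point: "swap_pairs k \<noteq> k"
  using exhaust_4[of k] by auto

lemma opposite_plane_complement:
  "opposite_plane 3 4 = opposite_plane 1 2" "opposite_plane 2 4 = opposite_plane 1 3"
  "opposite_plane 2 3 = opposite_plane 1 4"
proof -
  have *: "x $ 3 + x $ 4 = 0 \<longleftrightarrow> x $ 1 + x $ 2 = 0" "x $ 2 + x $ 4 = 0 \<longleftrightarrow> x $ 1 + x $ 3 = 0"
    "x $ 2 + x $ 3 = 0 \<longleftrightarrow> x $ 1 + x $ 4 = 0" if "psum 1 x = 0" for x
  proof -
    have "(x $ 1 + x $ 2) + (x $ 3 + x $ 4) = 0" "(x $ 1 + x $ 3) + (x $ 2 + x $ 4) = 0"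
      "(x $ 1 + x $ 4) + (x $ 2 + x $ 3) = 0"
      using that by (simp_all add: psum_def sum_4 ac_simps)
    then show "x $ 3 + x $ 4 = 0 \<longleftrightarrow> x $ 1 + x $ 2 = 0" "x $ 2 + x $ 4 = 0 \<longleftrightarrow> x $ 1 + x $ 3 = 0"
      "x $ 2 + x $ 3 = 0 \<longleftrightarrow> x $ 1 + x $ 4 = 0"
      by (metis add_0 add_0_right)+
  qed
  show "opposite_plane 3 4 = opposite_plane 1 2" "opposite_plane 2 4 = opposite_plane 1 3"
    "opposite_plane 2 3 = opposite_plane 1 4"
    unfolding opposite_plane_def using * by auto
qed

lemma opposite_plane_commute: "opposite_plane i j = opposite_plane j i"
  by (simp add: opposite_plane_def add.commute)

lemma opposite_plane_cases:
  assumes "i \<noteq> j"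
  shows "opposite_plane i j \<in> {opposite_plane 1 2, opposite_plane 1 3, opposite_plane 1 4}"
  using exhaust_4[of i] exhaust_4[of j] assms
  by (elim disjE) (simp_all add: opposite_plane_complement
    opposite_plane_commute[of 2 1] opposite_plane_commute[of 3 1] opposite_plane_commute[of 4 1]
    opposite_plane_commute[of 3 2] opposite_plane_commute[of 4 2] opposite_plane_commute[of 4 3])

lemma opposite_planes_distinct:
  "opposite_plane 1 2 \<noteq> opposite_plane 1 3" "opposite_plane 1 2 \<noteq> opposite_plane 1 4"
  "opposite_plane 1 3 \<noteq> opposite_plane 1 4"
proof -
  have "vec4 1 (-1) 2 (-2) \<in> opposite_plane 1 2 - opposite_plane 1 3 - opposite_plane 1 4"
    by (simp add: opposite_plane_def psum_vec4)
  moreover have "vec4 1 2 (-1) (-2) \<in> opposite_plane 1 3 - opposite_plane 1 4"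
    by (simp add: opposite_plane_def psum_vec4)
  ultimately show "opposite_plane 1 2 \<noteq> opposite_plane 1 3" "opposite_plane 1 2 \<noteq> opposite_plane 1 4"
    "opposite_plane 1 3 \<noteq> opposite_plane 1 4" by blast+
qed

lemma (in group) generate_involution:
  assumes "g \<in> carrier G" "g \<otimes> g = \<one>"
  shows "generate G {g} = {\<one>, g}"
proof
  have "subgroup {\<one>, g} G"
    by (rule subgroupI) (use assms inv_equality[of g g] in auto)
  then show "generate G {g} \<subseteq> {\<one>, g}"
    by (rule generate_subgroup_incl[rotated]) simp
  show "{\<one>, g} \<subseteq> generate G {g}"
    by (auto intro: generate.one generate.incl)
qed

interpretation S4: group S4 by (rule group_BijGroup)

lemma C2_eq: "C2 = {id, Transposition.transpose 1 2}"
  unfolding C2_def by (subst S4.generate_involution) (simp_all add: carrier_S4 mult_S4 one_S4)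

lemma C2'_eq: "C2' = {id, swap_pairs}"
proof -
  have "swap_pairs \<circ> swap_pairs = id" by (simp add: fun_eq_iff swap_pairs_involution)
  then have "generate S4 {swap_pairs} = {id, swap_pairs}"
    by (subst S4.generate_involution) (simp_all add: carrier_S4 mult_S4 one_S4 bij_swap_pairs)
  then show ?thesis by (simp add: C2'_def swap_pairs_def)
qed

lemma subgroup_C2: "subgroup C2 S4" and subgroup_C2': "subgroup C2' S4"
  unfolding C2_def C2'_def by (auto intro!: S4.generate_is_subgroup simp: carrier_S4 bij_comp)

lemma card_C2: "card C2 = 2" and card_C2': "card C2' = 2"
proof -
  have "Transposition.transpose 1 (2::4) 1 \<noteq> id 1" "swap_pairs 1 \<noteq> id 1" by simp_all
  then have "Transposition.transpose 1 (2::4) \<noteq> id" "swap_pairs \<noteq> id" by metis+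
  then show "card C2 = 2" "card C2' = 2" by (auto simp: C2_eq C2'_eq)
qed

text \<open>Elements of \<open>C2\<close> have fixed points in the index set, and \<open>swap_pairs\<close> has none.\<close>

lemma C2_not_conjugate: "\<not> conjugate_in S4 C2 C2'"
proof
  assume "conjugate_in S4 C2 C2'"
  then obtain g where g: "bij g" "C2' = g <#\<^bsub>S4\<^esub> C2 #>\<^bsub>S4\<^esub> inv\<^bsub>S4\<^esub> g"
    by (auto simp: conjugate_in_def carrier_S4)
  have "swap_pairs \<in> C2'" by (simp add: C2'_eq)
  then obtain h where h: "h \<in> C2" "swap_pairs = g \<otimes>\<^bsub>S4\<^esub> h \<otimes>\<^bsub>S4\<^esub> inv\<^bsub>S4\<^esub> g"
    using g(2) by (auto simp: l_coset_def r_coset_def)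
  have "bij h" using h(1) by (auto simp: C2_eq)
  then have "swap_pairs \<otimes>\<^bsub>S4\<^esub> g = g \<otimes>\<^bsub>S4\<^esub> h"
  proof -
    have "g \<in> carrier S4" "h \<in> carrier S4" using g(1) \<open>bij h\<close> by (simp_all add: carrier_S4)
    then show ?thesis unfolding h(2) by (simp add: S4.m_assoc)
  qed
  then have "swap_pairs \<circ> g = g \<circ> h"
    using g(1) \<open>bij h\<close> by (simp add: mult_S4 bij_swap_pairs)
  then have "swap_pairs (g 3) = g (h 3)" by (metis comp_apply)
  moreover have "h 3 = 3" using h(1) by (auto simp: C2_eq Transposition.transpose_def)
  ultimately show False using swap_pairs_no_fixed_point by simp
qed

context smooth_symmetric_cubic
begin

lemma base_planes_on_surface:
  assumes "V \<in> base_planes" "x \<in> V" shows "sym_form a b c x x x = 0"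
proof -
  consider "x \<in> opposite_plane 1 2" | "x \<in> eckardt_plane" | "x \<in> crossing_plane"
    using assms by (auto simp: base_planes_def)
  then show ?thesis
  proof cases
    case 1
    then obtain A B where "x = vec4 A (-A) B (-B)" by (auto simp: opposite_plane_12 span_pair_iff)
    then show ?thesis using sym_form_pairs[of a b c 0 0 A 0 B] by simp
  next
    case 2
    then obtain \<alpha> \<beta> where "x = \<alpha> *s vec4 1 (-1) 0 0 + \<beta> *s vec4 p0 p0 (q0 + z0) (q0 - z0)"
      unfolding eckardt_plane_def span_pair_iff by blast
    then have "x = vec4 (\<beta> * p0 + \<alpha>) (\<beta> * p0 - \<alpha>) (\<beta> * q0 + \<beta> * z0) (\<beta> * q0 - \<beta> * z0)"
      by (simp add: algebra_simps)
    then have "sym_form a b c x x x = \<beta> * (\<beta>^2 * end_coeff a b c p0 q0 + \<alpha>^2 * pair_coeff b c p0 q0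
        + (\<beta> * z0)^2 * pair_coeff b c q0 p0)"
      using sym_form_pairs[of a b c \<beta> p0 \<alpha> q0 "\<beta> * z0"] by simp
    also have "\<dots> = 0" using eckardt_parameters(2,4) by Groebner_Basis.algebra
    finally show ?thesis .
  next
    case 3
    then obtain \<alpha> \<beta> where "x = \<alpha> *s vec4 r1 1 (-r1) (-1) + \<beta> *s vec4 p1 q1 p1 q1"
      unfolding crossing_plane_def span_pair_iff by blast
    then have x: "x = vec4 (\<beta> * p1 + \<alpha> * r1) (\<beta> * q1 + \<alpha>) (\<beta> * p1 - \<alpha> * r1) (\<beta> * q1 - \<alpha>)"
      by simp
    let ?y = "perm_vec (Transposition.transpose 2 3) x"
    have "sym_form a b c x x x = sym_form a b c ?y ?y ?y" by (simp add: sym_form_perm)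
    also have "\<dots> = \<beta> * (\<beta>^2 * end_coeff a b c p1 q1 + (\<alpha> * r1)^2 * pair_coeff b c p1 q1
        + \<alpha>^2 * pair_coeff b c q1 p1)"
      unfolding x perm_vec4 by (rule sym_form_pairs)
    also have "\<dots> = 0" using crossing_parameters(3,6) by Groebner_Basis.algebra
    finally show ?thesis .
  qed
qed

text \<open>The vector \<open>(1, -1, 0, 0)\<close> spans the intersection with \<open>p\<^sub>1 = 0\<close>, so \<open>\<sigma>\<close> multiplies it by a scalar and preserves
\<open>{3, 4}\<close>. If \<open>\<sigma>\<close> exchanged 3 and 4, it would replace \<open>z0\<close> by \<open>- z0\<close> and give the other line through
the Eckardt point.\<close>

lemma eckardt_plane_stabilizer:
  assumes "bij \<sigma>"
  shows "perm_vec \<sigma> ` eckardt_plane = eckardt_plane \<longleftrightarrow> \<sigma> \<in> C2"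
proof
  let ?u = "vec4 1 (-1) 0 0" and ?w = "vec4 p0 p0 (q0 + z0) (q0 - z0)"
  have mem: "\<exists>\<alpha>. x = \<alpha> *s ?u + (psum 1 x / 2) *s ?w" if x: "x \<in> eckardt_plane" for x
  proof -
    obtain \<alpha> \<beta> where x: "x = \<alpha> *s ?u + \<beta> *s ?w" using x unfolding eckardt_plane_def span_pair_iff by blast
    have "psum 1 x = 2 * \<beta> * (p0 + q0)" unfolding x by (simp add: psum_vec4 algebra_simps)
    then have "psum 1 x / 2 = \<beta>" using eckardt_parameters(1) by simp
    then show ?thesis using x by blast
  qed
  have gens: "?u \<in> eckardt_plane" "?w \<in> eckardt_plane"
    unfolding eckardt_plane_def by (auto intro: vec.span_base)
  let ?\<tau> = "inv_into UNIV \<sigma>"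
  have inj: "?\<tau> k = ?\<tau> l \<longleftrightarrow> k = l" for k l
    using bij_imp_bij_inv[OF assms] by (auto simp: bij_def inj_eq)
  {
    assume stab: "perm_vec \<sigma> ` eckardt_plane = eckardt_plane"
    have "perm_vec \<sigma> ?u \<in> eckardt_plane" using gens(1) stab by blast
    moreover have "psum 1 (perm_vec \<sigma> ?u) = 0" by (simp add: psum_perm assms psum_vec4)
    ultimately obtain \<alpha> where "perm_vec \<sigma> ?u = \<alpha> *s ?u + (0 / 2) *s ?w" using mem by metis
    then have "perm_vec \<sigma> ?u = \<alpha> *s ?u" by simp
    then have u: "?u $ ?\<tau> k = \<alpha> * ?u $ k" for k by (metis perm_vec_nth vector_smult_component)
    have "?u $ ?\<tau> 3 = 0" "?u $ ?\<tau> 4 = 0" using u[of 3] u[of 4] by simp_all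
    then have 34: "?\<tau> 3 = 3 \<or> ?\<tau> 3 = 4" "?\<tau> 4 = 3 \<or> ?\<tau> 4 = 4"
      using exhaust_4[of "?\<tau> 3"] exhaust_4[of "?\<tau> 4"] by auto
    have "?\<tau> 3 \<noteq> 4"
    proof
      assume "?\<tau> 3 = 4"
      have "perm_vec \<sigma> ?w \<in> eckardt_plane" using gens(2) stab by blast
      moreover have "psum 1 ?w = 2 * (p0 + q0)" by (simp add: psum_vec4)
      then have "psum 1 (perm_vec \<sigma> ?w) / 2 = 1" by (simp only: psum_perm[OF assms] eckardt_parameters(1)) simp
      ultimately obtain \<alpha> where "perm_vec \<sigma> ?w = \<alpha> *s ?u + 1 *s ?w" using mem by metis
      then have "perm_vec \<sigma> ?w $ 3 = (\<alpha> *s ?u + 1 *s ?w) $ 3" by simp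
      then have "q0 - z0 = q0 + z0" using \<open>?\<tau> 3 = 4\<close> by simp
      then have "2 * z0 = 0" by Groebner_Basis.algebra
      then show False using eckardt_parameters(5) by simp
    qed
    with 34 have 34: "?\<tau> 3 = 3" "?\<tau> 4 = 4" using inj[of 3 4] by auto
    then have "?\<tau> 1 \<in> {1, 2}" "?\<tau> 2 \<in> {1, 2}" "?\<tau> 1 \<noteq> ?\<tau> 2"
      using exhaust_4[of "?\<tau> 1"] exhaust_4[of "?\<tau> 2"] inj[of 1 3] inj[of 1 4] inj[of 2 3] inj[of 2 4] inj[of 1 2]
      by auto
    then consider "?\<tau> 1 = 1" "?\<tau> 2 = 2" | "?\<tau> 1 = 2" "?\<tau> 2 = 1" by auto
    then show "\<sigma> \<in> C2"
    proof cases
      case 1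
      have "\<sigma> = id"
      proof (rule bij_eq_if_inv_eq[OF assms])
        show "?\<tau> k = id k" for k using exhaust_4[of k] 1 34 by auto
      qed simp
      then show ?thesis by (simp add: C2_eq)
    next
      case 2
      have "\<sigma> = Transposition.transpose 1 2"
      proof (rule bij_eq_if_inv_eq[OF assms])
        show "?\<tau> k = Transposition.transpose 1 2 k" for k
          using exhaust_4[of k] 2 34 by (auto simp: Transposition.transpose_def)
      qed simp
      then show ?thesis by (simp add: C2_eq)
    qed
  }
  {
    assume "\<sigma> \<in> C2"
    then consider "\<sigma> = id" | "\<sigma> = Transposition.transpose 1 2" by (auto simp: C2_eq)
    then show "perm_vec \<sigma> ` eckardt_plane = eckardt_plane"
    proof cases
      case 1
      then show ?thesis by simp
    next
      case 2
      show ?thesis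
      proof (rule perm_plane_eqI[OF _ eckardt_plane_def assms])
        show "vec.dim eckardt_plane = 2" by (rule base_planes_dim) (simp add: base_planes_def)
        have "perm_vec \<sigma> ?u = (-1) *s ?u + 0 *s ?w" "perm_vec \<sigma> ?w = 0 *s ?u + 1 *s ?w" by (simp_all add: 2)
        then show "perm_vec \<sigma> ?u \<in> eckardt_plane" "perm_vec \<sigma> ?w \<in> eckardt_plane"
          unfolding eckardt_plane_def span_pair_iff by blast+
      qed
    qed
  }
qed

text \<open>Again \<open>\<sigma>\<close> multiplies the vector \<open>u\<close> that spans the intersection with \<open>p\<^sub>1 = 0\<close> by a scalar \<open>\<alpha>\<close>.
Since \<open>\<alpha>\<close> permutes the entries of \<open>u\<close>, it is 1 or -1 by \<open>r1_generic\<close>. Since the entries are distinct, \<open>\<alpha>\<close>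
determines \<open>\<sigma>\<close>.\<close>

lemma crossing_plane_stabilizer:
  assumes "bij \<sigma>"
  shows "perm_vec \<sigma> ` crossing_plane = crossing_plane \<longleftrightarrow> \<sigma> \<in> C2'"
proof
  let ?u = "vec4 r1 1 (-r1) (-1)" and ?w = "vec4 p1 q1 p1 q1"
  have mem: "\<exists>\<alpha>. x = \<alpha> *s ?u" if x: "x \<in> crossing_plane" "psum 1 x = 0" for x
  proof -
    obtain \<alpha> \<beta> where x_eq: "x = \<alpha> *s ?u + \<beta> *s ?w" using x(1) unfolding crossing_plane_def span_pair_iff by blast
    have "psum 1 x = 2 * \<beta> * (p1 + q1)" unfolding x_eq by (simp add: psum_vec4 algebra_simps)
    then have "\<beta> = 0" using crossing_parameters(1) x(2) by simp
    then show ?thesis using x_eq by auto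
  qed
  let ?\<tau> = "inv_into UNIV \<sigma>"
  have r: "r1 \<noteq> 0" "r1 \<noteq> 1" "r1 \<noteq> - 1" using r1_generic(1,2) by auto
  then have r': "- r1 \<noteq> 1" by (metis minus_minus)
  have u_inj: "?u $ k = ?u $ l \<Longrightarrow> k = l" for k l
    using exhaust_4[of k] exhaust_4[of l] r r' by auto
  have u_values: "?u $ k \<in> {1, -1, r1, -r1}" for k using exhaust_4[of k] by auto
  {
    assume stab: "perm_vec \<sigma> ` crossing_plane = crossing_plane"
    have "?u \<in> crossing_plane" unfolding crossing_plane_def by (auto intro: vec.span_base)
    then have "perm_vec \<sigma> ?u \<in> crossing_plane" using stab by blast
    moreover have "psum 1 (perm_vec \<sigma> ?u) = 0" by (simp add: psum_perm assms psum_vec4)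
    ultimately obtain \<alpha> where "perm_vec \<sigma> ?u = \<alpha> *s ?u" using mem by blast
    then have u: "?u $ ?\<tau> k = \<alpha> * ?u $ k" for k by (metis perm_vec_nth vector_smult_component)
    have \<alpha>1: "\<alpha> \<in> {1, -1, r1, -r1}" using u_values[of "?\<tau> 2"] u[of 2] by simp
    have \<alpha>2: "\<alpha> * r1 \<in> {1, -1, r1, -r1}" using u_values[of "?\<tau> 1"] u[of 1] by simp
    have \<alpha>sq: "\<alpha>^2 = 1 \<or> \<alpha>^2 = r1^2" using \<alpha>1 by auto
    have "(\<alpha> * r1)^2 = 1 \<or> (\<alpha> * r1)^2 = r1^2" using \<alpha>2 by auto
    then have "\<alpha>^2 * r1^2 = 1 \<or> \<alpha>^2 * r1^2 = r1^2" by (simp add: power_mult_distrib)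
    with \<alpha>sq have "\<alpha>^2 = 1 \<or> r1^2 * r1^2 = 1 \<or> r1^2 * r1^2 = r1^2" by metis
    moreover have "r1^2 * r1^2 \<noteq> 1" using r1_generic by (metis square_eq_1_iff)
    moreover have "r1^2 * r1^2 \<noteq> r1^2" unfolding mult_cancel_right2 using r1_generic by simp
    ultimately have "\<alpha>^2 = 1" by blast
    then consider "\<alpha> = 1" | "\<alpha> = - 1" by (auto simp: power2_eq_1_iff)
    then show "\<sigma> \<in> C2'"
    proof cases
      case 1
      have "\<sigma> = id"
        by (rule bij_eq_if_inv_eq[OF assms]) (use u u_inj 1 in simp_all)
      then show ?thesis by (simp add: C2'_eq)
    next
      case 2
      have "\<sigma> = swap_pairs"
      proof (rule bij_eq_if_inv_eq[OF assms])
        have neg: "?u $ swap_pairs k = - ?u $ k" for k using exhaust_4[of k] by auto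
        then show "?\<tau> k = swap_pairs k" for k using u[of k] 2 by (intro u_inj) simp
      qed (rule swap_pairs_involution)
      then show ?thesis by (simp add: C2'_eq)
    qed
  }
  {
    assume "\<sigma> \<in> C2'"
    then consider "\<sigma> = id" | "\<sigma> = swap_pairs" by (auto simp: C2'_eq)
    then show "perm_vec \<sigma> ` crossing_plane = crossing_plane"
    proof cases
      case 1
      then show ?thesis by simp
    next
      case 2
      show ?thesis
      proof (rule perm_plane_eqI[OF _ crossing_plane_def assms])
        show "vec.dim crossing_plane = 2" by (rule base_planes_dim) (simp add: base_planes_def)
        have "perm_vec \<sigma> ?u = (-1) *s ?u + 0 *s ?w" "perm_vec \<sigma> ?w = 0 *s ?u + 1 *s ?w" by (simp_all add: 2)
        then show "perm_vec \<sigma> ?u \<in> crossing_plane" "perm_vec \<sigma> ?w \<in> crossing_plane"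
          unfolding crossing_plane_def span_pair_iff by blast+
      qed
    qed
  }
qed

end

section \<open>The three orbits of lines\<close>

locale symmetric_cubic_surface = smooth_symmetric_cubic a b c for a b c +
  fixes F :: "4 cpoly"
  assumes equation: "eval_poly F x = sym_form a b c x x x"
    and symmetric: "symmetric_surface (zero_locus F)"
begin

abbreviation "X \<equiv> zero_locus F"

sublocale act: group_action S4 "lines_on X" "line_action X"
  using is_gset_lines[OF symmetric] by (simp add: is_gset_def lines_gset_def)

lemma lines_eq:
  "lines_on X = pline ` {W. vec.subspace W \<and> vec.dim W = 2 \<and> (\<forall>x\<in>W. sym_form a b c x x x = 0)}"
proof -
  have "eval_poly F 0 = 0" by (simp add: equation)
  from lines_on_zero_locus[OF this] show ?thesis by (simp add: equation)
qed

lemma base_line: "V \<in> base_planes \<Longrightarrow> pline V \<in> lines_on X"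
  using base_planes_dim base_planes_on_surface by (auto simp: lines_eq)

lemma line_action_pline:
  assumes "bij \<sigma>" "pline W \<in> lines_on X"
  shows "line_action X \<sigma> (pline W) = pline (perm_vec \<sigma> ` W)"
  using assms by (simp add: line_action_def perm_point_pline)

lemma stabilizer_base_line:
  assumes "V \<in> base_planes"
  shows "stabilizer S4 (line_action X) (pline V) = {\<sigma>. bij \<sigma> \<and> perm_vec \<sigma> ` V = V}"
proof -
  have "line_action X \<sigma> (pline V) = pline V \<longleftrightarrow> perm_vec \<sigma> ` V = V" if "bij \<sigma>" for \<sigma>
    using base_planes_dim(1)[OF assms] base_line[OF assms] that
    by (simp add: line_action_pline pline_eq_iff subspace_perm_image)
  then show ?thesis by (auto simp: stabilizer_def carrier_S4)
qed

abbreviation "eckardt_orbit \<equiv> orbit S4 (line_action X) (pline eckardt_plane)"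
abbreviation "crossing_orbit \<equiv> orbit S4 (line_action X) (pline crossing_plane)"
abbreviation "opposite_orbit \<equiv> orbit S4 (line_action X) (pline (opposite_plane 1 2))"

lemma base_lines:
  "pline eckardt_plane \<in> lines_on X" "pline crossing_plane \<in> lines_on X" "pline (opposite_plane 1 2) \<in> lines_on X"
  by (auto intro!: base_line simp: base_planes_def)

lemma lines_decomposition: "lines_on X = eckardt_orbit \<union> crossing_orbit \<union> opposite_orbit"
proof
  show "lines_on X \<subseteq> eckardt_orbit \<union> crossing_orbit \<union> opposite_orbit"
  proof
    fix l assume l: "l \<in> lines_on X"
    then obtain W where W: "vec.subspace W" "vec.dim W = 2" "\<And>x. x \<in> W \<Longrightarrow> sym_form a b c x x x = 0"
      and l_eq: "l = pline W"
      by (auto simp: lines_eq)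
    obtain \<sigma> where \<sigma>: "bij \<sigma>" "perm_vec \<sigma> ` W \<in> base_planes"
      using every_line_moves_to_base[OF W] by (auto simp: moves_to_base_def)
    then have "pline (perm_vec \<sigma> ` W) = line_action X \<sigma> l"
      using l l_eq by (simp add: line_action_pline)
    then have "pline (perm_vec \<sigma> ` W) \<in> orbit S4 (line_action X) l"
      using \<sigma>(1) by (auto simp: orbit_def carrier_S4)
    then have "l \<in> orbit S4 (line_action X) (pline (perm_vec \<sigma> ` W))"
      using l base_line[OF \<sigma>(2)] act.orbit_sym by blast
    then show "l \<in> eckardt_orbit \<union> crossing_orbit \<union> opposite_orbit"
      using \<sigma>(2) by (auto simp: base_planes_def)
  qed
  show "eckardt_orbit \<union> crossing_orbit \<union> opposite_orbit \<subseteq> lines_on X"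
    using act.orbit_subset base_lines by blast
qed

lemma stabilizer_eckardt: "stabilizer S4 (line_action X) (pline eckardt_plane) = C2"
proof -
  have "C2 \<subseteq> Collect bij" by (auto simp: C2_eq)
  then show ?thesis
    using eckardt_plane_stabilizer
    by (subst stabilizer_base_line) (simp add: base_planes_def, blast)
qed

lemma stabilizer_crossing: "stabilizer S4 (line_action X) (pline crossing_plane) = C2'"
proof -
  have "C2' \<subseteq> Collect bij" by (auto simp: C2'_eq bij_swap_pairs)
  then show ?thesis
    using crossing_plane_stabilizer
    by (subst stabilizer_base_line) (simp add: base_planes_def, blast)
qed

lemma card_eckardt_orbit: "card eckardt_orbit = 12"
  using act.orbit_stabilizer_theorem[OF base_lines(1)]
  by (simp add: stabilizer_eckardt card_C2 order_S4)

lemma card_crossing_orbit: "card crossing_orbit = 12"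
  using act.orbit_stabilizer_theorem[OF base_lines(2)]
  by (simp add: stabilizer_crossing card_C2' order_S4)

lemma opposite_orbit_eq:
  "opposite_orbit = pline ` {opposite_plane 1 2, opposite_plane 1 3, opposite_plane 1 4}"
proof
  have act: "line_action X \<sigma> (pline (opposite_plane 1 2)) = pline (opposite_plane (\<sigma> 1) (\<sigma> 2))" if "bij \<sigma>" for \<sigma>
    using that base_lines(3) by (simp add: line_action_pline opposite_plane_perm)
  show "opposite_orbit \<subseteq> pline ` {opposite_plane 1 2, opposite_plane 1 3, opposite_plane 1 4}"
  proof
    fix l assume "l \<in> opposite_orbit"
    then obtain \<sigma> :: "4 \<Rightarrow> 4" where \<sigma>: "bij \<sigma>" "l = pline (opposite_plane (\<sigma> 1) (\<sigma> 2))"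
      by (auto simp: orbit_def carrier_S4 act)
    have "\<sigma> 1 \<noteq> \<sigma> 2" using \<sigma>(1) by (auto simp: bij_def inj_eq)
    from opposite_plane_cases[OF this] show "l \<in> pline ` {opposite_plane 1 2, opposite_plane 1 3, opposite_plane 1 4}"
      unfolding \<sigma>(2) by (rule imageI)
  qed
  have "pline (opposite_plane 1 j) \<in> opposite_orbit" if "j \<noteq> 1" for j
  proof -
    have "line_action X (Transposition.transpose 2 j) (pline (opposite_plane 1 2)) \<in> opposite_orbit"
      unfolding orbit_def using bij_transpose[of 2 j] by (auto simp: carrier_S4)
    moreover have "line_action X (Transposition.transpose 2 j) (pline (opposite_plane 1 2)) = pline (opposite_plane 1 j)"
      using that by (subst act) (simp_all add: Transposition.transpose_def)
    ultimately show ?thesis by simp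
  qed
  from this[of 2] this[of 3] this[of 4]
  show "pline ` {opposite_plane 1 2, opposite_plane 1 3, opposite_plane 1 4} \<subseteq> opposite_orbit" by simp
qed

lemma card_opposite_orbit: "card opposite_orbit = 3"
proof -
  have sub: "vec.subspace (opposite_plane i j)" for i j
  proof -
    have "opposite_plane i j = {x. psum 1 x = 0} \<inter> {x. x $ i + x $ j = 0}"
      by (auto simp: opposite_plane_def)
    moreover have "vec.subspace {x :: complex^4. psum 1 x = 0}"
      by (simp add: vec.subspace_def psum_def sum.distrib flip: sum_distrib_left)
    moreover have "vec.subspace {x :: complex^4. x $ i + x $ j = 0}"
      by (auto simp: vec.subspace_def add_eq_0_iff2 simp flip: distrib_left)
    ultimately show ?thesis by (simp add: vec.subspace_inter)
  qed
  have "inj_on pline {opposite_plane 1 2, opposite_plane 1 3, opposite_plane 1 4}"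
    by (rule inj_onI) (metis sub pline_eq_iff insertE singletonD)
  then show ?thesis
    using opposite_planes_distinct by (simp add: opposite_orbit_eq card_image)
qed

lemma orbits_distinct:
  "eckardt_orbit \<noteq> crossing_orbit" "eckardt_orbit \<noteq> opposite_orbit" "crossing_orbit \<noteq> opposite_orbit"
proof -
  show "eckardt_orbit \<noteq> crossing_orbit"
  proof
    assume "eckardt_orbit = crossing_orbit"
    then have "pline crossing_plane \<in> eckardt_orbit" using act.orbit_refl[OF base_lines(2)] by simp
    from act.stabilizer_conjugate[OF base_lines(1) this] show False
      using C2_not_conjugate by (simp add: stabilizer_eckardt stabilizer_crossing)
  qed
  show "eckardt_orbit \<noteq> opposite_orbit" "crossing_orbit \<noteq> opposite_orbit"
    using card_eckardt_orbit card_crossing_orbit card_opposite_orbit by auto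
qed

lemma orbits_disjoint:
  "eckardt_orbit \<inter> crossing_orbit = {}" "(eckardt_orbit \<union> crossing_orbit) \<inter> opposite_orbit = {}"
proof -
  have orb: "eckardt_orbit \<in> orbits S4 (lines_on X) (line_action X)"
    "crossing_orbit \<in> orbits S4 (lines_on X) (line_action X)"
    "opposite_orbit \<in> orbits S4 (lines_on X) (line_action X)"
    using base_lines by (auto simp: orbits_def)
  have "eckardt_orbit \<inter> opposite_orbit = {}" "crossing_orbit \<inter> opposite_orbit = {}"
    using act.disjoint_union orb orbits_distinct by blast+
  then show "(eckardt_orbit \<union> crossing_orbit) \<inter> opposite_orbit = {}" by blast
  show "eckardt_orbit \<inter> crossing_orbit = {}"
    using act.disjoint_union orb orbits_distinct by blast
qed

lemma orbits_eq: "orbits S4 (lines_on X) (line_action X) = {eckardt_orbit, crossing_orbit, opposite_orbit}"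
proof
  show "orbits S4 (lines_on X) (line_action X) \<subseteq> {eckardt_orbit, crossing_orbit, opposite_orbit}"
  proof
    fix Q assume "Q \<in> orbits S4 (lines_on X) (line_action X)"
    then obtain l where l: "l \<in> lines_on X" "Q = orbit S4 (line_action X) l" by (auto simp: orbits_def)
    then consider "l \<in> eckardt_orbit" | "l \<in> crossing_orbit" | "l \<in> opposite_orbit"
      using lines_decomposition by blast
    then show "Q \<in> {eckardt_orbit, crossing_orbit, opposite_orbit}"
    proof cases
      case 1
      then show ?thesis using act.orbit_eq[OF base_lines(1)] l(2) by simp
    next
      case 2
      then show ?thesis using act.orbit_eq[OF base_lines(2)] l(2) by simp
    next
      case 3
      then show ?thesis using act.orbit_eq[OF base_lines(3)] l(2) by simp
    qed
  qed
  show "{eckardt_orbit, crossing_orbit, opposite_orbit} \<subseteq> orbits S4 (lines_on X) (line_action X)"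
    using base_lines by (auto simp: orbits_def)
qed

lemma card_lines: "card (lines_on X) = 27"
proof -
  have fin: "finite eckardt_orbit" "finite crossing_orbit" "finite opposite_orbit"
    using card_eckardt_orbit card_crossing_orbit card_opposite_orbit by (auto intro: card_ge_0_finite)
  show ?thesis
    unfolding lines_decomposition using fin orbits_disjoint
    by (simp add: card_Un_disjoint card_eckardt_orbit card_crossing_orbit card_opposite_orbit)
qed

text \<open>A group of order 8 acting on three lines fixes one of them. The stabilizer of that line also has order 8.\<close>

lemma stabilizer_opposite:
  assumes D: "subgroup D S4" "card D = 8"
  shows "\<exists>l\<in>opposite_orbit. stabilizer S4 (line_action X) l = D"
proof -
  let ?H = "S4\<lparr>carrier := D\<rparr>" and ?Y = "subgset (line_action X) opposite_orbit"
  have "is_gset S4 ?Y" by (rule act.is_gset_orbit[OF base_lines(3)])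
  moreover have "group ?H" using D(1) by (rule S4.subgroup_imp_group)
  ultimately have "is_gset ?H ?Y"
    using subgroup.subset[OF D(1)] unfolding is_gset_iff by (auto simp: subset_iff)
  then interpret H: group_action ?H opposite_orbit "\<lambda>g. restrict (line_action X g) opposite_orbit"
    by (simp add: is_gset_def subgset_def)
  have "\<exists>l\<in>opposite_orbit. stabilizer ?H (\<lambda>g. restrict (line_action X g) opposite_orbit) l = carrier ?H"
  proof (rule H.p_group_fixed_point)
    show "prime (2::nat)" by (rule two_is_prime_nat)
    show "order ?H = 2 ^ 3" using D(2) by (simp add: order_def)
    show "finite opposite_orbit" using card_opposite_orbit by (auto intro: card_ge_0_finite)
    show "\<not> 2 dvd card opposite_orbit" by (simp add: card_opposite_orbit)
  qed
  then obtain l where l: "l \<in> opposite_orbit"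
    and fixed: "stabilizer ?H (\<lambda>g. restrict (line_action X g) opposite_orbit) l = D" by auto
  let ?S = "stabilizer S4 (line_action X) l"
  have "D \<subseteq> ?S"
    using fixed l subgroup.subset[OF D(1)] by (auto simp: stabilizer_def)
  moreover have lX: "l \<in> lines_on X" using l base_lines(3) act.orbit_subset by blast
  have "card (orbit S4 (line_action X) l) * card ?S = 24"
    using act.orbit_stabilizer_theorem[OF lX] by (simp add: order_S4)
  then have "card ?S = 8"
    using act.orbit_eq[OF base_lines(3) l] by (simp add: card_opposite_orbit)
  ultimately have "?S = D"
    using D(2) card_subset_eq[of ?S D] by (metis card.infinite zero_neq_numeral)
  with l show ?thesis by blast
qed

end

theorem theorem1p2:
  fixes F :: "4 cpoly" and D8 :: "(4 \<Rightarrow> 4) set"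
  assumes "homogeneous 3 F"
    and "smooth_surface F"
    and "symmetric_surface (zero_locus F)"
    and "subgroup D8 S4"
    and "dihedral_group 4 (S4\<lparr>carrier := D8\<rparr>)"
  shows "card (lines_on (zero_locus F)) = 27 \<and>
    (subgroup C2 S4 \<and> subgroup C2' S4 \<and> card C2 = 2 \<and> card C2' = 2 \<and>
      \<not> conjugate_in S4 C2 C2') \<and>
    gset_iso S4 (lines_gset (zero_locus F))
      (gset_sum (gset_sum (coset_gset S4 C2) (coset_gset S4 C2')) (coset_gset S4 D8)) \<and>
    (\<exists>O1 O2 O3.
      orbits S4 (lines_on (zero_locus F)) (line_action (zero_locus F)) = {O1, O2, O3} \<and>
      O1 \<noteq> O2 \<and> O1 \<noteq> O3 \<and> O2 \<noteq> O3 \<and>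
      card O1 = 12 \<and> card O2 = 12 \<and> card O3 = 3 \<and>
      (\<forall>l\<in>O1. conjugate_in S4 C2 (stabilizer S4 (line_action (zero_locus F)) l)) \<and>
      (\<forall>l\<in>O2. conjugate_in S4 C2' (stabilizer S4 (line_action (zero_locus F)) l)) \<and>
      (\<forall>l\<in>O3. conjugate_in S4 D8 (stabilizer S4 (line_action (zero_locus F)) l)))"
proof -
  obtain a b c where "smooth_cubic_form (sym_form a b c)"
    and eq: "\<And>x. eval_poly F x = sym_form a b c x x x"
    using symmetric_cubic_normal_form[OF assms(1-3)] by blast
  then interpret smooth_symmetric_cubic a b c by (intro smooth_symmetric_cubic.intro)
  interpret symmetric_cubic_surface a b c F
    by unfold_locales (rule eq assms(3))+
  have "card D8 = 8" using assms(5) by (simp add: dihedral_group_def order_def)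
  then obtain l0 where l0: "l0 \<in> opposite_orbit" "stabilizer S4 (line_action X) l0 = D8"
    using stabilizer_opposite[OF assms(4)] by blast
  have l0X: "l0 \<in> lines_on X" using l0 base_lines(3) act.orbit_subset by blast
  have l0_orbit: "orbit S4 (line_action X) l0 = opposite_orbit"
    by (rule act.orbit_eq[OF base_lines(3) l0(1)])
  have "lines_gset X = subgset (line_action X) (eckardt_orbit \<union> crossing_orbit \<union> opposite_orbit)"
    unfolding lines_decomposition[symmetric]
    by (simp add: lines_gset_def subgset_def line_action_def fun_eq_iff)
  moreover have "gset_iso S4 (subgset (line_action X) (eckardt_orbit \<union> crossing_orbit \<union> opposite_orbit))
      (gset_sum (gset_sum (coset_gset S4 C2) (coset_gset S4 C2')) (coset_gset S4 D8))"
    using act.orbit_iso_cosets[OF base_lines(1)] act.orbit_iso_cosets[OF base_lines(2)]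
      act.orbit_iso_cosets[OF l0X]
    unfolding stabilizer_eckardt stabilizer_crossing l0(2) l0_orbit
    by (intro gset_iso_disjoint_union orbits_disjoint)
  ultimately have iso: "gset_iso S4 (lines_gset X)
      (gset_sum (gset_sum (coset_gset S4 C2) (coset_gset S4 C2')) (coset_gset S4 D8))" by simp
  have "\<forall>l\<in>eckardt_orbit. conjugate_in S4 C2 (stabilizer S4 (line_action X) l)"
    using act.stabilizer_conjugate[OF base_lines(1)] by (simp add: stabilizer_eckardt)
  moreover have "\<forall>l\<in>crossing_orbit. conjugate_in S4 C2' (stabilizer S4 (line_action X) l)"
    using act.stabilizer_conjugate[OF base_lines(2)] by (simp add: stabilizer_crossing)
  moreover have "\<forall>l\<in>opposite_orbit. conjugate_in S4 D8 (stabilizer S4 (line_action X) l)"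
    using act.stabilizer_conjugate[OF l0X] by (simp add: l0(2) l0_orbit)
  ultimately show ?thesis
    using card_lines subgroup_C2 subgroup_C2' card_C2 card_C2' C2_not_conjugate iso
      orbits_eq orbits_distinct card_eckardt_orbit card_crossing_orbit card_opposite_orbit
    by blast
qed

end
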